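(* Let $a,b,c\in\mathbb{R}$ satisfy either ($c=0$ and $a\neq b$) or ($c>0$ and $a<b$), let $\nu\geq\max\{0,\nu_0\}$ with $Q(\nu)\neq0$, and let $\lambda_{\nu,k}$ denote the $k$th positive zero of $N_\nu$. Then for every integer $n\geq1$ $$\sum_{1\leq k_1<k_2<\cdots<k_n}\frac{1}{\lambda_{\nu,k_1}^2\lambda_{\nu,k_2}^2\cdots\lambda_{\nu,k_n}^2}=\frac{Q(2n+\nu)}{n!\,4^n(\nu+1)_n\,Q(\nu)},$$ and $$\sum_{k=1}^{\infty}\frac{4^n(-1)^n}{\lambda_{\nu,k}^{2n}}=\det(M_n),$$ where $M_n=(m_{ij})_{1\le i,j\le n}$ is the $n\times n$ matrix whose last column is $$m_{in}=\frac{-Q(\nu+2i)}{(i-1)!\,(\nu+1)_i\,Q(\nu)}\qquad(1\le i\le n),$$ and whose entries in the columns $1\le j\le n-1$ are $$m_{ij}=\begin{cases}\dfrac{Q(\nu+2(i-j))}{(i-j)!\,(\nu+1)_{i-j}\,Q(\nu)}, & i>j,\\[2mm] 1,& i=j,\\ 0,& i<j.\end{cases}$$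
   Context: $J_\nu(z)=\sum_{n\ge 0}\frac{(-1)^n}{n!\,\Gamma(n+\nu+1)}\left(\frac z2\right)^{2n+\nu}$ is the Bessel function of the first kind of order $\nu$. For real $a,b,c$ put $N_\nu(z)=az^2J_\nu''(z)+bzJ_\nu'(z)+cJ_\nu(z)$ and $Q(\nu)=a\nu(\nu-1)+b\nu+c$. $\nu_0$ denotes the largest real root of the quadratic $Q$ (if $Q$ has no real root, $\max\{0,\nu_0\}$ is read as $0$). $(x)_n=x(x+1)\cdots(x+n-1)$ is the Pochhammer symbol. *)

theory Defs
  imports "HOL-Complex_Analysis.Complex_Analysis" "Jordan_Normal_Form.Determinant"
begin

(* Principal branch of the power. Since 0 powr 0 = 0 in Isabelle, the value at z = 0 for order 0
   is not the usual one; only positive arguments matter below. *)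
definition Bessel_J :: "real \<Rightarrow> complex \<Rightarrow> complex" where
  "Bessel_J \<nu> z =
     (\<Sum>n. (-1) ^ n / (fact n * Gamma (of_nat n + of_real \<nu> + 1))
            * (z / 2) powr (2 * of_nat n + of_real \<nu>))"

definition Bessel_N :: "real \<Rightarrow> real \<Rightarrow> real \<Rightarrow> real \<Rightarrow> complex \<Rightarrow> complex" where
  "Bessel_N a b c \<nu> z =
     of_real a * z ^ 2 * deriv (deriv (Bessel_J \<nu>)) z
     + of_real b * z * deriv (Bessel_J \<nu>) z
     + of_real c * Bessel_J \<nu> z"

definition Q :: "real \<Rightarrow> real \<Rightarrow> real \<Rightarrow> real \<Rightarrow> real" where
  "Q a b c \<nu> = a * \<nu> * (\<nu> - 1) + b * \<nu> + c"

(* max {0, nu_0}, where nu_0 is the largest real root of Q, read as 0 if Q has no real root.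
   The set of roots is finite unless a = b = c = 0. *)
definition max_0_nu0 :: "real \<Rightarrow> real \<Rightarrow> real \<Rightarrow> real" where
  "max_0_nu0 a b c =
     (if \<exists>x. Q a b c x = 0 then max 0 (Max {x. Q a b c x = 0}) else 0)"

(* The k-th smallest positive zero, for k \<ge> 1. If card is k \<ge> 1, the set is finite. *)
definition kth_pos_zero :: "(complex \<Rightarrow> complex) \<Rightarrow> nat \<Rightarrow> real" where
  "kth_pos_zero f k =
     (THE x. 0 < x \<and> f (of_real x) = 0 \<and>
             card {y::real. 0 < y \<and> y \<le> x \<and> f (of_real y) = 0} = k)"

definition Bessel_N_zero :: "real \<Rightarrow> real \<Rightarrow> real \<Rightarrow> real \<Rightarrow> nat \<Rightarrow> real" where
  "Bessel_N_zero a b c \<nu> k = kth_pos_zero (Bessel_N a b c \<nu>) k"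

definition M_entry ::
  "real \<Rightarrow> real \<Rightarrow> real \<Rightarrow> real \<Rightarrow> nat \<Rightarrow> nat \<Rightarrow> nat \<Rightarrow> real" where
  "M_entry a b c \<nu> n i j =
     (if j = n then
        - Q a b c (\<nu> + 2 * real i) / (fact (i - 1) * pochhammer (\<nu> + 1) i * Q a b c \<nu>)
      else if i > j then
        Q a b c (\<nu> + 2 * real (i - j))
          / (fact (i - j) * pochhammer (\<nu> + 1) (i - j) * Q a b c \<nu>)
      else if i = j then 1
      else 0)"

(* M_entry is indexed from 1, the library's matrices from 0. *)
definition M_matrix :: "real \<Rightarrow> real \<Rightarrow> real \<Rightarrow> real \<Rightarrow> nat \<Rightarrow> real Matrix.mat" where
  "M_matrix a b c \<nu> n = Matrix.mat n n (\<lambda>(i, j). M_entry a b c \<nu> n (i + 1) (j + 1))"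

end

theory Submission imports Defs begin

text \<open>
  Up to a nonzero factor, \<open>N\<^sub>\<nu>(z)\<close> is \<open>z\<^sup>\<nu> F(z\<^sup>2)\<close> with the entire function
  \<open>F(w) = \<Sum> (-1)\<^sup>n Q(2n+\<nu>) / (n! (\<nu>+1)\<^sub>n 4\<^sup>n Q(\<nu>)) w\<^sup>n\<close> of order 1/2, normalised by \<open>F(0) = 1\<close>
  (\<open>Bessel_N_eq\<close>). Suppose that all zeros of \<open>F\<close> are positive and simple. Then they are exactly
  the squares of the positive zeros of \<open>N\<^sub>\<nu>\<close>, listed without repetition, and since the order is
  below 1 the product of the factors \<open>1 - w/\<lambda>\<^sub>k\<^sup>2\<close> is \<open>F\<close> itself, with no exponential factor.
  Comparing Taylor coefficients gives the elementary symmetric functions of the numbers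
  \<open>\<lambda>\<^sub>k\<^sup>-\<^sup>2\<close>, which is the first formula. Newton's identities then form a unipotent lower
  triangular Toeplitz system for the power sums, and Cramer's rule for its last unknown is the
  second formula.

  The product formula is \<open>uniform_limit_zero_product\<close>. Divide \<open>F\<close> by the finite product over
  its zeros in the disc of radius \<open>R\<close>. On the circle of radius \<open>2R\<close> this product has modulus at
  least 1, so by the maximum principle the quotient inherits the bound on \<open>F\<close>, its logarithm has
  real part \<open>O(R\<^sup>1\<^sup>/\<^sup>2)\<close> on the disc of radius \<open>R\<close>, and the Borel-Caratheodory inequality forces the
  logarithm to tend to 0 on compact sets. No convergence of the product has to be known
  beforehand: it is part of the conclusion.

  The location of the zeros is \<open>alternating_real_rooted_N\<close>. The starting point is the Bessel case
  \<open>Q = 1\<close>, called \<open>f\<close> below. Its zeros are real by a Sturm-Liouville (Lommel) argument and simple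
  by its differential equation, and its product formula shows that \<open>w f'/f\<close> maps the upper half
  plane to the lower one. Hence a combination \<open>A f + B w f' - a w f\<close> with \<open>B > 0\<close> and \<open>a \<ge> 0\<close> has
  only real and simple zeros (\<open>Laguerre_step\<close>), and the sign pattern of its coefficients excludes
  zeros on the negative axis. If \<open>(b-a)/Q(\<nu>) > 0\<close> and \<open>a/Q(\<nu>) \<ge> 0\<close>, eliminating the second
  derivative by Bessel's equation exhibits \<open>F\<close> as such a combination. In all other cases \<open>Q\<close> is
  a quadratic with two real roots, and \<open>F\<close> arises from \<open>f\<close> by two such steps with \<open>a = 0\<close>, one for
  each root; the roots lie below \<open>\<nu>\<close>, which makes both values of \<open>B\<close> positive.
\<close>

section \<open>Factorisation of entire functions of order at most 1/2\<close>
text \<open>The Moebius map \<open>u \<mapsto> u / (2A - u)\<close> takes the half plane \<open>Re u < A\<close> into the unit disc and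
  fixes 0, so the inequality is Schwarz's lemma for its composition with \<open>h\<close>.\<close>
lemma Borel_Caratheodory_zero:
  assumes hol: "h holomorphic_on ball 0 R" and h0: "h 0 = 0"
    and A: "0 < A" "\<And>z. norm z < R \<Longrightarrow> Re (h z) < A"
    and w: "norm w < R"
  shows "norm (h w) \<le> 2 * A * norm w / (R - norm w)"
proof -
  have R: "R > 0" using w norm_ge_zero[of w] by linarith
  define \<phi> where "\<phi> = (\<lambda>z. h (of_real R * z) / (2 * of_real A - h (of_real R * z)))"
  have sub: "norm (of_real R * z) < R" if "norm z < 1" for z :: complex
    using that R by (simp add: norm_mult)
  have lt: "norm (h z) < norm (2 * of_real A - h z)" if "norm z < R" for z
  proof -
    have "(norm (2 * of_real A - h z))\<^sup>2 = (norm (h z))\<^sup>2 + 4 * A * (A - Re (h z))"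
      unfolding cmod_power2 by (simp add: power2_eq_square algebra_simps)
    moreover have "4 * A * (A - Re (h z)) > 0" using A that by simp
    ultimately have "(norm (h z))\<^sup>2 < (norm (2 * of_real A - h z))\<^sup>2" by linarith
    thus ?thesis by (rule power_less_imp_less_base) simp
  qed
  have nz: "2 * of_real A - h z \<noteq> 0" if "norm z < R" for z
    using lt[OF that] norm_ge_zero[of "h z"] by auto
  have "(h \<circ> (\<lambda>z. of_real R * z)) holomorphic_on ball 0 1"
    by (rule holomorphic_on_compose_gen[OF _ hol]) (use sub in \<open>auto intro!: holomorphic_intros\<close>)
  hence hol': "(\<lambda>z. h (of_real R * z)) holomorphic_on ball 0 1" by (simp add: o_def)
  have "\<phi> holomorphic_on ball 0 1"
    unfolding \<phi>_def by (intro holomorphic_intros hol') (use nz sub in auto)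
  moreover have "\<phi> 0 = 0" by (simp add: \<phi>_def h0)
  moreover have "norm (\<phi> z) < 1" if "norm z < 1" for z
    using lt[OF sub[OF that]] nz[OF sub[OF that]] by (simp add: \<phi>_def norm_divide)
  moreover have "norm (w / of_real R) < 1" using w R by (simp add: norm_divide)
  ultimately have "norm (\<phi> (w / of_real R)) \<le> norm (w / of_real R)"
    by (rule Schwarz_Lemma(1))
  hence "norm (h w) / norm (2 * of_real A - h w) \<le> norm w / R"
    using R by (simp add: \<phi>_def norm_divide)
  hence "norm (h w) * R \<le> norm w * norm (2 * of_real A - h w)"
    using nz[OF w] R by (simp add: field_simps)
  also have "\<dots> \<le> norm w * (2 * A + norm (h w))"
    using norm_triangle_ineq4[of "2 * of_real A" "h w"] A
    by (intro mult_left_mono) (auto simp: norm_mult)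
  finally have "norm (h w) * (R - norm w) \<le> 2 * A * norm w" by (simp add: algebra_simps)
  thus ?thesis using w by (simp add: field_simps)
qed

lemma divide_simple_zeros:
  assumes "finite S" "F holomorphic_on UNIV" "0 \<notin> S"
    and "\<And>z. z \<in> S \<Longrightarrow> F z = 0"
  shows "\<exists>G. G holomorphic_on UNIV \<and> (\<forall>w. F w = (\<Prod>z\<in>S. 1 - w / z) * G w)"
  using assms
proof (induction S rule: finite_induct)
  case empty
  thus ?case by auto
next
  case (insert x S)
  then obtain G where G: "G holomorphic_on UNIV" "\<And>w. F w = (\<Prod>z\<in>S. 1 - w / z) * G w" by auto
  have x0: "x \<noteq> 0" and S0: "\<And>z. z \<in> S \<Longrightarrow> z \<noteq> 0" using insert.prems by auto
  have "(\<Prod>z\<in>S. 1 - x / z) \<noteq> 0"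
    using insert.hyps S0 by (auto simp: field_simps)
  hence Gx: "G x = 0" using G(2)[of x] insert.prems(3)[of x] by auto
  define H where "H = (\<lambda>z. if z = x then deriv G x else (G z - G x) / (z - x))"
  have "H holomorphic_on UNIV"
    unfolding H_def by (rule pole_lemma_open) (use G in auto)
  moreover have "G w = (1 - w / x) * (- x * H w)" for w
    using x0 Gx by (cases "w = x") (auto simp: H_def field_simps)
  ultimately show ?case using G insert.hyps
    by (intro exI[of _ "\<lambda>w. - x * H w"]) (auto intro!: holomorphic_intros simp: mult_ac)
qed

definition zeros_upto :: "(complex \<Rightarrow> complex) \<Rightarrow> real \<Rightarrow> complex set" where
  "zeros_upto F R = {z. F z = 0 \<and> norm z \<le> R}"

definition zero_product :: "(complex \<Rightarrow> complex) \<Rightarrow> real \<Rightarrow> complex \<Rightarrow> complex" where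
  "zero_product F R w = (\<Prod>z\<in>zeros_upto F R. 1 - w / z)"

lemma holomorphic_zero_product: "zero_product F R holomorphic_on A"
  unfolding zero_product_def divide_inverse by (intro holomorphic_intros)

lemma finite_zeros_upto:
  assumes "F holomorphic_on UNIV" "F 0 = 1"
  shows "finite (zeros_upto F R)"
proof (cases "\<exists>x. F x = 0")
  case True
  then obtain x where "F x = 0" by blast
  hence "\<not> F constant_on UNIV" using assms(2) by (metis UNIV_I constant_on_def zero_neq_one)
  hence "finite {z \<in> cball 0 R. F z = 0}"
    by (intro holomorphic_compact_finite_zeros[OF assms(1)]) auto
  thus ?thesis by (rule finite_subset[rotated]) (auto simp: zeros_upto_def)
qed (auto simp: zeros_upto_def)

text \<open>The bound on \<open>F\<close> is only needed on the circle of radius \<open>2R\<close>: there every factor \<open>1 - z/s\<close> with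
  \<open>\<bar>s\<bar> \<le> R\<close> has modulus at least 1, and the maximum principle carries the bound for the quotient
  inwards. Simplicity of the zeros guarantees that the quotient has no zeros left in the open disc
  of radius \<open>R\<close>, hence has a logarithm there.\<close>
lemma factor_out_zeros_upto:
  assumes hol: "F holomorphic_on UNIV" and F0: "F 0 = 1"
    and simple: "\<And>z. F z = 0 \<Longrightarrow> deriv F z \<noteq> 0"
    and B: "\<And>z. norm z = 2 * R \<Longrightarrow> norm (F z) \<le> B"
    and w: "norm w < R"
  shows "\<exists>h. F w = zero_product F R w * exp h \<and>
             norm h \<le> 2 * (ln B + 1) * norm w / (R - norm w)"
proof -
  have R: "R > 0" using w norm_ge_zero[of w] by linarith
  let ?S = "zeros_upto F R"
  have fin: "finite ?S" by (rule finite_zeros_upto[OF hol F0])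
  have S0: "0 \<notin> ?S" by (simp add: zeros_upto_def F0)
  obtain G where G: "G holomorphic_on UNIV" "\<And>w. F w = zero_product F R w * G w"
    using divide_simple_zeros[OF fin hol S0] unfolding zero_product_def by (auto simp: zeros_upto_def)
  have diff: "f field_differentiable at z" if "f holomorphic_on UNIV" for f :: "complex \<Rightarrow> complex" and z
    using that by (auto simp: holomorphic_on_def)
  have Gnz: "G z \<noteq> 0" if z: "norm z < R" for z
  proof
    assume Gz: "G z = 0"
    hence Fz: "F z = 0" using G(2) by simp
    hence zS: "z \<in> ?S" using z by (simp add: zeros_upto_def)
    have P0: "zero_product F R z = 0"
      unfolding zero_product_def using fin zS S0 by (auto intro!: bexI[of _ z])
    have "deriv (\<lambda>w. zero_product F R w * G w) z
            = zero_product F R z * deriv G z + deriv (zero_product F R) z * G z"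
      by (intro deriv_mult diff G holomorphic_zero_product)
    moreover have "F = (\<lambda>w. zero_product F R w * G w)" using G(2) by auto
    ultimately have "deriv F z = 0" using P0 Gz by simp
    thus False using simple[OF Fz] by simp
  qed
  have P00: "zero_product F R 0 = 1" by (simp add: zero_product_def)
  hence G0: "G 0 = 1" using G(2)[of 0] F0 by simp
  have bound: "norm (G z) \<le> B" if z: "norm z \<le> 2 * R" for z
  proof (rule maximum_modulus_frontier[of G "cball 0 (2 * R)"])
    show "G holomorphic_on interior (cball 0 (2 * R))" using G(1) holomorphic_on_subset by blast
    show "continuous_on (closure (cball 0 (2 * R))) G"
      using G(1) holomorphic_on_imp_continuous_on continuous_on_subset by blast
    fix x assume "x \<in> frontier (cball (0::complex) (2 * R))"
    hence x: "norm x = 2 * R" using R by (simp add: sphere_def)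
    have "1 \<le> norm (zero_product F R x)"
      unfolding zero_product_def prod_norm[symmetric]
    proof (rule prod_ge_1)
      fix s assume s: "s \<in> ?S"
      hence "norm s \<le> R" "norm s > 0" using S0 by (auto simp: zeros_upto_def)
      hence "norm (x / s) \<ge> 2" using x by (simp add: norm_divide field_simps)
      thus "1 \<le> norm (1 - x / s)" using norm_triangle_ineq2[of "x / s" 1] by (simp add: norm_minus_commute)
    qed
    hence "norm (G x) \<le> norm (zero_product F R x) * norm (G x)"
      by (simp add: mult_le_cancel_right1)
    also have "\<dots> = norm (F x)" by (simp add: G(2) norm_mult)
    also have "\<dots> \<le> B" by (rule B[OF x])
    finally show "norm (G x) \<le> B" .
  qed (use z in auto)
  have B1: "B \<ge> 1" using bound[of 0] R G0 by simp
  obtain g where g: "g holomorphic_on ball 0 R" "\<And>z. z \<in> ball 0 R \<Longrightarrow> G z = exp (g z)"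
  proof (rule contractible_imp_holomorphic_log[of G "ball 0 R"])
    show "G holomorphic_on ball 0 R" by (rule holomorphic_on_subset[OF G(1)]) simp
    show "contractible (ball (0::complex) R)" by (rule convex_imp_contractible[OF convex_ball])
  qed (use Gnz in auto)
  define h where "h = (\<lambda>z. g z - g 0)"
  have "exp (g 0) = 1" using g(2)[of 0] G0 R by simp
  hence h: "G z = exp (h z)" if "norm z < R" for z
    using g(2)[of z] that by (simp add: h_def exp_diff)
  have "norm (h w) \<le> 2 * (ln B + 1) * norm w / (R - norm w)"
  proof (rule Borel_Caratheodory_zero)
    show "h holomorphic_on ball 0 R" unfolding h_def by (intro holomorphic_intros g)
    show "h 0 = 0" by (simp add: h_def)
    show "0 < ln B + 1" using B1 by (simp add: add_nonneg_pos)
    fix z :: complex assume z: "norm z < R"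
    have "exp (Re (h z)) = norm (G z)" using h[OF z] by (simp add: norm_exp_eq_Re)
    also have "\<dots> \<le> B" using bound z R by simp
    finally have "Re (h z) \<le> ln B" using B1 by (simp add: ln_ge_iff)
    thus "Re (h z) < ln B + 1" by simp
  qed (use w in auto)
  thus ?thesis using G(2)[of w] h[OF w] by auto
qed

text \<open>Here the order enters: the logarithm of the quotient on a fixed disc is
  \<open>O(R\<^sup>1\<^sup>/\<^sup>2 / R)\<close> as \<open>R \<rightarrow> \<infinity>\<close>.\<close>
lemma uniform_limit_zero_product:
  assumes hol: "F holomorphic_on UNIV" and F0: "F 0 = 1"
    and simple: "\<And>z. F z = 0 \<Longrightarrow> deriv F z \<noteq> 0"
    and growth: "\<And>z. norm (F z) \<le> C * exp (D * sqrt (norm z))" and D: "D \<ge> 0"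
  shows "uniform_limit (ball 0 \<rho>) (\<lambda>R. zero_product F R) F at_top"
proof (cases "\<rho> > 0")
  case False
  hence empty: "ball (0::complex) \<rho> = {}" by simp
  show ?thesis unfolding uniform_limit_iff empty by simp
next
  case \<rho>: True
  have C1: "C \<ge> 1" using growth[of 0] F0 by simp
  have "bounded (F ` cball 0 \<rho>)"
    by (intro compact_imp_bounded compact_continuous_image compact_cball
          continuous_on_subset[OF holomorphic_on_imp_continuous_on[OF hol]]) simp
  then obtain M where M: "M > 0" "\<And>z. norm z \<le> \<rho> \<Longrightarrow> norm (F z) \<le> M"
    unfolding bounded_pos by (auto simp: image_iff)
  define \<delta> where "\<delta> = (\<lambda>R. 2 * (ln C + D * sqrt (2 * R) + 1) * \<rho> / (R - \<rho>))"
  have \<delta>: "(\<delta> \<longlongrightarrow> 0) at_top" 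
  proof (rule Lim_transform_eventually)
    have inv: "((\<lambda>R::real. 1 / R) \<longlongrightarrow> 0) at_top" "((\<lambda>R. 1 / sqrt R) \<longlongrightarrow> 0) at_top"
      by (rule real_tendsto_divide_at_top[OF tendsto_const filterlim_ident]
            real_tendsto_divide_at_top[OF tendsto_const sqrt_at_top])+
    have "((\<lambda>R. 2 * ((ln C + 1) * (1 / R) + D * sqrt 2 * (1 / sqrt R)) * \<rho> / (1 - \<rho> * (1 / R))) \<longlongrightarrow>
        2 * ((ln C + 1) * 0 + D * sqrt 2 * 0) * \<rho> / (1 - \<rho> * 0)) at_top"
      by (intro tendsto_intros inv) simp
    thus "((\<lambda>R. 2 * ((ln C + 1) * (1 / R) + D * sqrt 2 * (1 / sqrt R)) * \<rho> / (1 - \<rho> * (1 / R))) \<longlongrightarrow> 0) at_top"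
      by simp
    show "\<forall>\<^sub>F R in at_top. 2 * ((ln C + 1) * (1 / R) + D * sqrt 2 * (1 / sqrt R)) * \<rho> / (1 - \<rho> * (1 / R)) = \<delta> R"
      using eventually_gt_at_top[of "max 0 \<rho>"]
    proof eventually_elim
      case (elim R)
      have s: "sqrt 2 * (1 / sqrt R) = sqrt (2 * R) / R"
        using elim by (simp add: real_sqrt_mult field_simps)
      have "1 - \<rho> * (1 / R) = (R - \<rho>) / R" using elim by (simp add: field_simps)
      moreover have "(ln C + 1) * (1 / R) + D * sqrt 2 * (1 / sqrt R) = (ln C + D * sqrt (2 * R) + 1) / R"
      proof -
        have "D * sqrt 2 * (1 / sqrt R) = D * (sqrt (2 * R) / R)" using s by (simp only: mult.assoc)
        thus ?thesis by (simp add: add_divide_distrib)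
      qed
      ultimately show ?case using elim by (simp add: \<delta>_def)
    qed
  qed
  show ?thesis unfolding uniform_limit_iff
  proof (intro allI impI)
    fix e :: real assume e: "e > 0"
    \<comment> \<open>The bound 1/2 is the range in which \<open>exp u - 1\<close> is at most \<open>3/2 \<bar>u\<bar>\<close>.\<close>
    define e' where "e' = min (1/2) (e / (2 * M))"
    have e': "e' > 0" using e M by (simp add: e'_def)
    have "eventually (\<lambda>R. \<delta> R < e' \<and> R > 2 * \<rho>) at_top"
      using order_tendstoD(2)[OF \<delta> e'] eventually_gt_at_top[of "2 * \<rho>"] by eventually_elim auto
    thus "\<forall>\<^sub>F R in at_top. \<forall>w\<in>ball 0 \<rho>. dist (zero_product F R w) (F w) < e"
    proof eventually_elim
      case (elim R)
      have R: "R > 2 * \<rho>" "R > 0" using elim \<rho> by auto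
      show ?case
      proof
        fix w :: complex assume "w \<in> ball 0 \<rho>"
        hence w: "norm w < \<rho>" by simp
        have "norm (F z) \<le> C * exp (D * sqrt (2 * R))" if "norm z = 2 * R" for z
          using growth[of z] that by simp
        moreover have "norm w < R" using w R \<rho> by linarith
        ultimately obtain h where h: "F w = zero_product F R w * exp h"
          "norm h \<le> 2 * (ln (C * exp (D * sqrt (2 * R))) + 1) * norm w / (R - norm w)"
          using factor_out_zeros_upto[OF hol F0 simple, of R "C * exp (D * sqrt (2 * R))" w] by blast
        have "norm h \<le> 2 * (ln C + D * sqrt (2 * R) + 1) * norm w / (R - norm w)"
          using h(2) C1 by (simp add: ln_mult)
        also have "\<dots> \<le> \<delta> R"
        proof -
          have "0 \<le> ln C + D * sqrt (2 * R) + 1"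
            using C1 D R by (intro add_nonneg_nonneg mult_nonneg_nonneg ln_ge_zero) auto
          thus ?thesis unfolding \<delta>_def using w R \<rho>
            by (intro frac_le mult_left_mono mult_nonneg_nonneg) auto
        qed
        finally have "norm h < e'" using elim by simp
        hence hh: "norm (- h) \<le> 1/2" "norm h < e / (2 * M)" by (auto simp: e'_def)
        have "dist (zero_product F R w) (F w) = norm (F w * (exp (- h) - 1))"
          using h(1) by (simp add: dist_norm right_diff_distrib mult.assoc flip: exp_add)
        also have "\<dots> \<le> M * (3/2 * norm (- h))"
          unfolding norm_mult using M w norm_exp_bounds(2)[OF hh(1)] by (intro mult_mono) auto
        also have "\<dots> < e" using hh(2) M e by (simp add: field_simps)
        finally show "dist (zero_product F R w) (F w) < e" .
      qed
    qed
  qed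
qed

section \<open>Power series with coefficients of size \<open>D\<^sup>n / n!\<^sup>2\<close>\<close>
definition power_series :: "(nat \<Rightarrow> real) \<Rightarrow> complex \<Rightarrow> complex" where
  "power_series c w = (\<Sum>n. of_real (c n) * w ^ n)"

text \<open>A coefficient condition that implies order at most 1/2 and that, unlike a condition on the
  growth of the function, is visibly stable under all operations used below.\<close>
definition sq_fact_bounded :: "(nat \<Rightarrow> real) \<Rightarrow> bool" where
  "sq_fact_bounded c \<longleftrightarrow> (\<exists>C D. \<forall>n. \<bar>c n\<bar> \<le> C * D ^ n / (fact n)\<^sup>2)"

lemma sq_fact_boundedE:
  assumes "sq_fact_bounded c"
  obtains C D where "C \<ge> 0" "D \<ge> 1" "\<And>n. \<bar>c n\<bar> \<le> C * D ^ n / (fact n)\<^sup>2"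
proof -
  obtain C D where CD: "\<bar>c n\<bar> \<le> C * D ^ n / (fact n)\<^sup>2" for n
    using assms unfolding sq_fact_bounded_def by blast
  have "\<bar>c n\<bar> \<le> \<bar>C\<bar> * (max 1 \<bar>D\<bar>) ^ n / (fact n)\<^sup>2" for n
  proof -
    have "C * D ^ n \<le> \<bar>C * D ^ n\<bar>" by simp
    also have "\<dots> = \<bar>C\<bar> * \<bar>D\<bar> ^ n" by (simp add: abs_mult power_abs)
    also have "\<dots> \<le> \<bar>C\<bar> * (max 1 \<bar>D\<bar>) ^ n" by (intro mult_left_mono power_mono) auto
    finally have "C * D ^ n / (fact n)\<^sup>2 \<le> \<bar>C\<bar> * (max 1 \<bar>D\<bar>) ^ n / (fact n)\<^sup>2"
      by (intro divide_right_mono) auto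
    thus ?thesis using CD[of n] by linarith
  qed
  thus ?thesis using that[of "\<bar>C\<bar>" "max 1 \<bar>D\<bar>"] by auto
qed

lemma sq_fact_bounded_add:
  assumes "sq_fact_bounded c" "sq_fact_bounded d"
  shows "sq_fact_bounded (\<lambda>n. c n + d n)"
proof -
  obtain C D where 1: "C \<ge> 0" "D \<ge> 1" "\<And>n. \<bar>c n\<bar> \<le> C * D ^ n / (fact n)\<^sup>2"
    using assms(1) by (rule sq_fact_boundedE) blast
  obtain C' D' where 2: "C' \<ge> 0" "D' \<ge> 1" "\<And>n. \<bar>d n\<bar> \<le> C' * D' ^ n / (fact n)\<^sup>2"
    using assms(2) by (rule sq_fact_boundedE) blast
  have "\<bar>c n + d n\<bar> \<le> (C + C') * (max D D') ^ n / (fact n)\<^sup>2" for n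
  proof -
    have "\<bar>c n + d n\<bar> \<le> C * D ^ n / (fact n)\<^sup>2 + C' * D' ^ n / (fact n)\<^sup>2"
      using 1(3)[of n] 2(3)[of n] by linarith
    also have "\<dots> \<le> C * (max D D') ^ n / (fact n)\<^sup>2 + C' * (max D D') ^ n / (fact n)\<^sup>2"
      using 1 2 by (intro add_mono divide_right_mono mult_left_mono power_mono) auto
    also have "\<dots> = (C + C') * (max D D') ^ n / (fact n)\<^sup>2" by (simp add: add_divide_distrib ring_distribs)
    finally show ?thesis .
  qed
  thus ?thesis unfolding sq_fact_bounded_def by blast
qed

lemma sq_fact_bounded_cmult:
  assumes "sq_fact_bounded c" shows "sq_fact_bounded (\<lambda>n. k * c n)"
proof -
  obtain C D where 1: "\<And>n. \<bar>c n\<bar> \<le> C * D ^ n / (fact n)\<^sup>2"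
    using assms by (rule sq_fact_boundedE) blast
  have "\<bar>k * c n\<bar> \<le> (\<bar>k\<bar> * C) * D ^ n / (fact n)\<^sup>2" for n
    using mult_left_mono[OF 1[of n], of "\<bar>k\<bar>"] by (simp add: abs_mult mult.assoc)
  thus ?thesis unfolding sq_fact_bounded_def by blast
qed

lemma sq_fact_bounded_of_nat_mult:
  assumes "sq_fact_bounded c" shows "sq_fact_bounded (\<lambda>n. real n * c n)"
proof -
  obtain C D where 1: "C \<ge> 0" "D \<ge> 1" "\<And>n. \<bar>c n\<bar> \<le> C * D ^ n / (fact n)\<^sup>2"
    using assms by (rule sq_fact_boundedE) blast
  have "\<bar>real n * c n\<bar> \<le> C * (2 * D) ^ n / (fact n)\<^sup>2" for n
  proof -
    have "\<bar>real n * c n\<bar> \<le> 2 ^ n * (C * D ^ n / (fact n)\<^sup>2)"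
      unfolding abs_mult using 1(3)[of n] of_nat_less_two_power[of n, where ?'a = real] by (intro mult_mono) auto
    thus ?thesis by (simp add: power_mult_distrib mult_ac)
  qed
  thus ?thesis unfolding sq_fact_bounded_def by blast
qed

definition shift_coeff :: "(nat \<Rightarrow> real) \<Rightarrow> nat \<Rightarrow> real" where
  "shift_coeff c n = (if n = 0 then 0 else c (n - 1))"

lemma sq_fact_bounded_shift:
  assumes "sq_fact_bounded c" shows "sq_fact_bounded (shift_coeff c)"
proof -
  obtain C D where 1: "C \<ge> 0" "D \<ge> 1" "\<And>n. \<bar>c n\<bar> \<le> C * D ^ n / (fact n)\<^sup>2"
    using assms by (rule sq_fact_boundedE) blast
  have "\<bar>shift_coeff c n\<bar> \<le> C * (4 * D) ^ n / (fact n)\<^sup>2" for n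
  proof (cases n)
    case (Suc m)
    have "real (Suc m) \<le> 2 ^ Suc m" using of_nat_less_two_power[of "Suc m", where ?'a = real] by linarith
    hence "(real (Suc m))\<^sup>2 \<le> (2 ^ Suc m)\<^sup>2" by (intro power_mono) auto
    also have "\<dots> = 4 ^ Suc m"
      unfolding power2_eq_square power_mult_distrib[symmetric] by simp
    finally have "(real (Suc m))\<^sup>2 * D ^ m \<le> 4 ^ Suc m * D ^ Suc m"
      using 1 by (intro mult_mono power_increasing) auto
    hence "C * ((real (Suc m))\<^sup>2 * D ^ m) / (fact (Suc m))\<^sup>2 \<le> C * (4 ^ Suc m * D ^ Suc m) / (fact (Suc m))\<^sup>2"
      using 1 by (intro mult_left_mono divide_right_mono) auto
    moreover have "C * ((real (Suc m))\<^sup>2 * D ^ m) / (fact (Suc m))\<^sup>2 = C * D ^ m / (fact m)\<^sup>2"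
      by (simp add: power_mult_distrib del: of_nat_Suc)
    ultimately show ?thesis using 1(3)[of m] Suc by (simp add: shift_coeff_def power_mult_distrib mult_ac)
  qed (use 1 in \<open>simp add: shift_coeff_def\<close>)
  thus ?thesis unfolding sq_fact_bounded_def by blast
qed

text \<open>With \<open>x = (D \<bar>w\<bar>)\<^sup>1\<^sup>/\<^sup>2\<close> the \<open>n\<close>-th term is at most \<open>C (x\<^sup>n/n!)\<^sup>2 \<le> C e\<^sup>x x\<^sup>n/n!\<close>.\<close>
lemma ps_bound:
  assumes "sq_fact_bounded c"
  shows "\<exists>C D. C \<ge> 0 \<and> D \<ge> 0 \<and> (\<forall>w. summable (\<lambda>n. norm (of_real (c n) * w ^ n)) \<and>
           norm (power_series c w) \<le> C * exp (D * sqrt (norm w)))"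
proof -
  obtain C D where 1: "C \<ge> 0" "D \<ge> 1" "\<And>n. \<bar>c n\<bar> \<le> C * D ^ n / (fact n)\<^sup>2"
    using assms by (rule sq_fact_boundedE) blast
  have "summable (\<lambda>n. norm (of_real (c n) * w ^ n)) \<and>
        norm (power_series c w) \<le> C * exp ((2 * sqrt D) * sqrt (norm w))" for w :: complex
  proof -
    define x where "x = sqrt D * sqrt (norm w)"
    have x0: "x \<ge> 0" using 1 by (simp add: x_def)
    have x2: "x\<^sup>2 = D * norm w" using 1 by (simp add: x_def power_mult_distrib)
    have ex: "(\<lambda>n. x ^ n / fact n) sums exp x"
      using exp_converges[of x] by (simp add: divide_inverse mult.commute)
    have le: "norm (of_real (c n) * w ^ n) \<le> C * exp x * (x ^ n / fact n)" for n
    proof -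
      have "x ^ n / fact n = (\<Sum>k\<in>{n}. x ^ k / fact k)" by simp
      also have "\<dots> \<le> (\<Sum>k. x ^ k / fact k)"
        using x0 sums_summable[OF ex] by (intro sum_le_suminf) auto
      also have "\<dots> = exp x" using sums_unique[OF ex] by simp
      finally have one: "x ^ n / fact n \<le> exp x" .
      have xx: "x ^ n * x ^ n = D ^ n * norm w ^ n"
        by (metis x2 power2_eq_square power_mult_distrib)
      have "norm (of_real (c n) * w ^ n) \<le> C * D ^ n / (fact n)\<^sup>2 * norm w ^ n"
        unfolding norm_mult norm_power norm_of_real by (intro mult_right_mono 1) auto
      also have "\<dots> = C * (D ^ n * norm w ^ n) / (fact n)\<^sup>2" by simp
      also have "\<dots> = C * (x ^ n / fact n) * (x ^ n / fact n)"
        unfolding xx[symmetric] by (simp add: power2_eq_square)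
      also have "\<dots> \<le> C * exp x * (x ^ n / fact n)"
        using 1 x0 one by (intro mult_right_mono mult_left_mono) auto
      finally show ?thesis .
    qed
    have ex': "(\<lambda>n. C * exp x * (x ^ n / fact n)) sums (C * exp x * exp x)"
      by (intro sums_mult ex)
    have sm: "summable (\<lambda>n. norm (of_real (c n) * w ^ n))"
      using le by (intro summable_comparison_test'[OF sums_summable[OF ex'], of 0]) simp
    have "norm (power_series c w) \<le> (\<Sum>n. norm (of_real (c n) * w ^ n))"
      unfolding power_series_def by (rule summable_norm[OF sm])
    also have "\<dots> \<le> C * exp x * exp x"
      using suminf_le[OF le sm sums_summable[OF ex']] sums_unique[OF ex'] by simp
    also have "\<dots> = C * exp ((2 * sqrt D) * sqrt (norm w))"
      by (simp add: x_def mult.assoc flip: exp_add)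
    finally show ?thesis using sm by blast
  qed
  thus ?thesis using 1 by (intro exI[of _ C] exI[of _ "2 * sqrt D"]) auto
qed

lemma ps_sums:
  assumes "sq_fact_bounded c" shows "(\<lambda>n. of_real (c n) * w ^ n) sums power_series c w"
  unfolding power_series_def using ps_bound[OF assms] by (blast intro: summable_sums summable_norm_cancel)

lemma sq_fact_bounded_Suc:
  assumes "sq_fact_bounded c" shows "sq_fact_bounded (\<lambda>n. c (Suc n))"
proof -
  obtain C D where 1: "C \<ge> 0" "D \<ge> 1" "\<And>n. \<bar>c n\<bar> \<le> C * D ^ n / (fact n)\<^sup>2"
    using assms by (rule sq_fact_boundedE) blast
  have "\<bar>c (Suc n)\<bar> \<le> (C * D) * D ^ n / (fact n)\<^sup>2" for n
  proof -
    have "\<bar>c (Suc n)\<bar> \<le> C * D ^ Suc n / (fact (Suc n))\<^sup>2" by (rule 1)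
    also have "\<dots> \<le> C * D ^ Suc n / (fact n)\<^sup>2"
      using 1 by (intro divide_left_mono power_mono fact_mono mult_nonneg_nonneg mult_pos_pos) auto
    finally show ?thesis by (simp add: mult_ac)
  qed
  thus ?thesis unfolding sq_fact_bounded_def by blast
qed

definition deriv_coeff :: "(nat \<Rightarrow> real) \<Rightarrow> nat \<Rightarrow> real" where
  "deriv_coeff c n = real (Suc n) * c (Suc n)"

lemma sq_fact_bounded_deriv: "sq_fact_bounded c \<Longrightarrow> sq_fact_bounded (deriv_coeff c)"
  using sq_fact_bounded_Suc[OF sq_fact_bounded_of_nat_mult[of c]]
  by (simp add: deriv_coeff_def[abs_def])

lemma has_field_derivative_ps:
  assumes "sq_fact_bounded c"
  shows "(power_series c has_field_derivative power_series (deriv_coeff c) w) (at w)"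
proof -
  have "((\<lambda>w. \<Sum>n. of_real (c n) * w ^ n) has_field_derivative
         (\<Sum>n. diffs (\<lambda>n. of_real (c n)) n * w ^ n)) (at w)"
    by (rule termdiffs_strong_converges_everywhere) (use ps_sums[OF assms] sums_summable in blast)
  moreover have "diffs (\<lambda>n. complex_of_real (c n)) = (\<lambda>n. of_real (deriv_coeff c n))"
    by (simp add: diffs_def deriv_coeff_def fun_eq_iff)
  ultimately show ?thesis by (simp add: power_series_def[abs_def])
qed

lemma deriv_ps: "sq_fact_bounded c \<Longrightarrow> deriv (power_series c) = power_series (deriv_coeff c)"
  using has_field_derivative_ps DERIV_imp_deriv by blast

lemma holomorphic_ps: "sq_fact_bounded c \<Longrightarrow> power_series c holomorphic_on A"
  using has_field_derivative_ps holomorphic_on_open[of UNIV "power_series c"] holomorphic_on_subset by blast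

lemma ps_add:
  "sq_fact_bounded c \<Longrightarrow> sq_fact_bounded d \<Longrightarrow> power_series (\<lambda>n. c n + d n) w = power_series c w + power_series d w"
  using sums_add[OF ps_sums[of c w] ps_sums[of d w]] ps_sums[OF sq_fact_bounded_add, of c d w]
  by (simp add: ring_distribs sums_iff)

lemma ps_cmult: "sq_fact_bounded c \<Longrightarrow> power_series (\<lambda>n. k * c n) w = of_real k * power_series c w"
  using sums_mult[OF ps_sums[of c w], of "of_real k"] ps_sums[OF sq_fact_bounded_cmult, of c k w]
  by (simp add: mult.assoc sums_iff)

lemma ps_shift:
  assumes "sq_fact_bounded c" shows "power_series (shift_coeff c) w = w * power_series c w"
proof -
  have "(\<lambda>n. of_real (shift_coeff c (Suc n)) * w ^ Suc n) sums (w * power_series c w)"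
    using sums_mult[OF ps_sums[OF assms, of w], of w] by (simp add: shift_coeff_def mult_ac)
  hence "(\<lambda>n. of_real (shift_coeff c n) * w ^ n) sums (w * power_series c w)"
    using sums_Suc_iff[of "\<lambda>n. of_real (shift_coeff c n) * w ^ n"] by (simp add: shift_coeff_def)
  thus ?thesis using ps_sums[OF sq_fact_bounded_shift[OF assms], of w] sums_unique2 by blast
qed

text \<open>The Euler operator \<open>w d/dw\<close> acts diagonally on coefficients. This is why polynomials in it,
  such as the operator that produces \<open>N\<^sub>\<nu>\<close> from the Bessel function, are handled at the level of
  coefficients.\<close>
lemma ps_of_nat_mult:
  assumes "sq_fact_bounded c" shows "power_series (\<lambda>n. real n * c n) w = w * deriv (power_series c) w"
proof -
  have "shift_coeff (deriv_coeff c) = (\<lambda>n. real n * c n)"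
    by (auto simp: shift_coeff_def deriv_coeff_def fun_eq_iff)
  thus ?thesis using ps_shift[OF sq_fact_bounded_deriv[OF assms], of w] deriv_ps[OF assms] by simp
qed

lemma ps_0: "power_series c 0 = of_real (c 0)"
  using powser_sums_zero[of "\<lambda>n. of_real (c n)"] by (simp add: power_series_def sums_iff)

lemma higher_deriv_ps_0:
  "sq_fact_bounded c \<Longrightarrow> (deriv ^^ n) (power_series c) 0 = fact n * of_real (c n)"
proof (induction n arbitrary: c)
  case (Suc n)
  show ?case
    using Suc.IH[OF sq_fact_bounded_deriv[OF Suc.prems]]
    by (simp add: funpow_Suc_right deriv_ps[OF Suc.prems] algebra_simps del: funpow.simps)
       (simp add: deriv_coeff_def algebra_simps)
qed (simp add: ps_0)

lemma alternating_ps_nonzero: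
  assumes "sq_fact_bounded c" "\<And>n. (-1) ^ n * c n > 0" "x \<le> 0"
  shows "power_series c (of_real x) \<noteq> 0"
proof
  assume "power_series c (of_real x) = 0"
  hence "(\<lambda>n. complex_of_real (c n * x ^ n)) sums of_real 0"
    using ps_sums[OF assms(1), of "of_real x"] by simp
  hence s: "(\<lambda>n. c n * x ^ n) sums 0" unfolding sums_of_real_iff .
  have "c n * x ^ n \<ge> 0" for n
  proof -
    have "c n * x ^ n = ((-1) ^ n * c n) * (- x) ^ n"
      by (simp add: power_minus[of x] mult_ac flip: power_add)
    also have "\<dots> \<ge> 0"
      using assms(2)[of n] assms(3) by (intro mult_nonneg_nonneg[OF less_imp_le] zero_le_power) auto
    finally show ?thesis .
  qed
  hence "\<forall>n. c n * x ^ n = 0"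
    using suminf_eq_zero_iff[OF sums_summable[OF s]] sums_unique[OF s] by simp
  hence "c 0 * x ^ 0 = 0" by blast
  thus False using assms(2)[of 0] by simp
qed

section \<open>Zeros and coefficients\<close>
definition real_simple_zeros :: "(complex \<Rightarrow> complex) \<Rightarrow> bool" where
  "real_simple_zeros F \<longleftrightarrow> (\<forall>z. F z = 0 \<longrightarrow> z \<in> \<real> \<and> deriv F z \<noteq> 0)"

definition esym :: "'b set \<Rightarrow> ('b \<Rightarrow> 'a :: comm_ring_1) \<Rightarrow> nat \<Rightarrow> 'a" where
  "esym A x n = (\<Sum>T | T \<subseteq> A \<and> card T = n. \<Prod>k\<in>T. x k)"

lemma fps_nth_prod_one_minus:
  fixes x :: "'b \<Rightarrow> 'a :: comm_ring_1"
  assumes "finite A"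
  shows "fps_nth (\<Prod>k\<in>A. 1 - fps_const (x k) * fps_X) n = (-1) ^ n * esym A x n"
proof -
  have const: "(\<Prod>k\<in>T. fps_const (f k)) = fps_const (\<Prod>k\<in>T. f k)" for T :: "'b set" and f :: "'b \<Rightarrow> 'a"
    by (induction T rule: infinite_finite_induct) auto
  have "(\<Prod>k\<in>A. 1 - fps_const (x k) * fps_X) = (\<Prod>k\<in>A. fps_const (- x k) * fps_X + 1)"
    by (intro prod.cong) (auto simp flip: fps_const_neg)
  also have "\<dots> = (\<Sum>T\<in>Pow A. fps_const (\<Prod>k\<in>T. - x k) * fps_X ^ card T)"
    using assms by (subst prod_add) (simp_all add: prod.distrib const)
  finally have "fps_nth (\<Prod>k\<in>A. 1 - fps_const (x k) * fps_X) n =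
      (\<Sum>T\<in>Pow A. if card T = n then (\<Prod>k\<in>T. - x k) else 0)"
    by (auto simp: fps_sum_nth intro!: sum.cong)
  also have "\<dots> = (\<Sum>T | T \<subseteq> A \<and> card T = n. \<Prod>k\<in>T. - x k)"
    using assms by (subst sum.inter_filter[symmetric]) (auto simp: Pow_def intro!: sum.cong)
  also have "\<dots> = (-1) ^ n * esym A x n"
    unfolding esym_def sum_distrib_left by (intro sum.cong) (auto simp: prod_uminus)
  finally show ?thesis .
qed

lemma higher_deriv_prod_one_minus:
  fixes x :: "'b \<Rightarrow> complex"
  assumes "finite A"
  shows "(deriv ^^ n) (\<lambda>w. \<Prod>k\<in>A. 1 - x k * w) 0 / fact n = (-1) ^ n * esym A x n"
proof -
  have "(\<lambda>w. \<Prod>k\<in>A. 1 - x k * w) has_fps_expansion (\<Prod>k\<in>A. 1 - fps_const (x k) * fps_X)"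
    by (intro has_fps_expansion_prod has_fps_expansion_diff has_fps_expansion_mult
          has_fps_expansion_const has_fps_expansion_1 has_fps_expansion_fps_X)
  from fps_nth_fps_expansion[OF this, of n] show ?thesis
    by (simp add: fps_nth_prod_one_minus[OF assms])
qed

lemma uniform_limit_zero_product_ps:
  assumes c: "sq_fact_bounded c" "c 0 = 1" and rs: "real_simple_zeros (power_series c)"
  shows "uniform_limit (ball 0 \<rho>) (\<lambda>R. zero_product (power_series c) R) (power_series c) at_top"
proof -
  obtain C D where CD: "D \<ge> 0" "\<And>w. norm (power_series c w) \<le> C * exp (D * sqrt (norm w))"
    using ps_bound[OF c(1)] by blast
  show ?thesis
    by (rule uniform_limit_zero_product[of _ C D])
       (use CD rs c in \<open>auto simp: holomorphic_ps ps_0 real_simple_zeros_def\<close>)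
qed

lemma tendsto_higher_deriv_zero_product:
  assumes c: "sq_fact_bounded c" "c 0 = 1" and rs: "real_simple_zeros (power_series c)"
  shows "((\<lambda>R. (deriv ^^ n) (zero_product (power_series c) R) w) \<longlongrightarrow> (deriv ^^ n) (power_series c) w) at_top"
  by (rule higher_deriv_complex_uniform_limit[OF uniform_limit_zero_product_ps[OF assms, of "norm w + 1"]])
     (auto simp: holomorphic_zero_product)

text \<open>Locally uniform convergence of the finite products entails convergence of their Taylor
  coefficients at 0, which are the elementary symmetric functions of the inverse zeros.\<close>
lemma tendsto_esym_zeros_upto:
  assumes c: "sq_fact_bounded c" "c 0 = 1" and rs: "real_simple_zeros (power_series c)"
  shows "((\<lambda>R. esym (zeros_upto (power_series c) R) inverse n) \<longlongrightarrow> of_real ((-1) ^ n * c n)) at_top"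
proof -
  have fin: "finite (zeros_upto (power_series c) R)" for R
    by (rule finite_zeros_upto) (auto simp: c holomorphic_ps ps_0)
  have P: "zero_product (power_series c) R = (\<lambda>w. \<Prod>z\<in>zeros_upto (power_series c) R. 1 - inverse z * w)" for R
    by (simp add: zero_product_def fun_eq_iff divide_inverse mult.commute)
  have "((\<lambda>R. (-1) ^ n * ((deriv ^^ n) (zero_product (power_series c) R) 0 / fact n)) \<longlongrightarrow>
         (-1) ^ n * ((deriv ^^ n) (power_series c) 0 / fact n)) at_top"
    by (intro tendsto_intros tendsto_higher_deriv_zero_product assms) simp
  also have "(\<lambda>R. (-1) ^ n * ((deriv ^^ n) (zero_product (power_series c) R) 0 / fact n)) =
             (\<lambda>R. esym (zeros_upto (power_series c) R) inverse n)"
    unfolding P higher_deriv_prod_one_minus[OF fin] by (simp add: fun_eq_iff flip: mult.assoc power_add)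
  finally show ?thesis by (simp add: higher_deriv_ps_0[OF c(1)])
qed

text \<open>With finitely many zeros the products would stabilise at a polynomial, so almost all
  coefficients would vanish.\<close>
lemma infinite_zeros_ps:
  assumes c: "sq_fact_bounded c" "c 0 = 1" and rs: "real_simple_zeros (power_series c)"
    and nz: "\<And>n. c n \<noteq> 0"
  shows "infinite {z. power_series c z = 0}"
proof
  assume fin: "finite {z. power_series c z = 0}"
  define n where "n = Suc (card {z. power_series c z = 0})"
  have "esym (zeros_upto (power_series c) R) inverse n = 0" for R
  proof -
    have "card T \<noteq> n" if "T \<subseteq> zeros_upto (power_series c) R" for T
    proof -
      have "T \<subseteq> {z. power_series c z = 0}" using that by (auto simp: zeros_upto_def)
      from card_mono[OF fin this] show ?thesis by (simp add: n_def)
    qed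
    hence none: "{T. T \<subseteq> zeros_upto (power_series c) R \<and> card T = n} = {}" by blast
    show ?thesis unfolding esym_def none by simp
  qed
  hence "((\<lambda>_. 0) \<longlongrightarrow> complex_of_real ((-1) ^ n * c n)) (at_top :: real filter)"
    using tendsto_esym_zeros_upto[OF c rs, of n] by simp
  hence "complex_of_real ((-1) ^ n * c n) = 0"
    by (simp add: tendsto_const_iff)
  thus False using nz[of n] by simp
qed

lemma log_deriv_prod:
  fixes w :: complex
  assumes "finite S" "\<And>z. z \<in> S \<Longrightarrow> z \<noteq> 0" "w \<notin> S"
  shows "deriv (\<lambda>w. \<Prod>z\<in>S. 1 - w / z) w = (\<Prod>z\<in>S. 1 - w / z) * (\<Sum>z\<in>S. 1 / (w - z))"
proof -
  have "((\<lambda>w. \<Prod>z\<in>S. 1 - w / z) has_field_derivative (\<Prod>z\<in>S. 1 - w / z) * (\<Sum>z\<in>S. 1 / (w - z))) (at w)"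
    using assms
  proof (induction S rule: finite_induct)
    case (insert x S)
    have x: "x \<noteq> 0" "w \<noteq> x" using insert.prems by auto
    have 1: "((\<lambda>w. 1 - w / x) has_field_derivative (1 - w / x) * (1 / (w - x))) (at w)"
      using x by (auto intro!: derivative_eq_intros simp: divide_simps)
    have 2: "((\<lambda>w. \<Prod>z\<in>S. 1 - w / z) has_field_derivative
        (\<Prod>z\<in>S. 1 - w / z) * (\<Sum>z\<in>S. 1 / (w - z))) (at w)"
      using insert.prems by (intro insert.IH) auto
    define p q u v where "p = (\<Prod>z\<in>S. 1 - w / z)" and "q = (\<Sum>z\<in>S. 1 / (w - z))"
      and "u = 1 - w / x" and "v = 1 / (w - x)"
    have "u * v * p + p * q * u = u * p * (v + q)" by (simp add: algebra_simps)
    hence eq: "(1 - w / x) * (1 / (w - x)) * (\<Prod>z\<in>S. 1 - w / z) +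
        (\<Prod>z\<in>S. 1 - w / z) * (\<Sum>z\<in>S. 1 / (w - z)) * (1 - w / x) =
        (\<Prod>z\<in>insert x S. 1 - w / z) * (\<Sum>z\<in>insert x S. 1 / (w - z))"
      using insert.hyps by (simp only: p_def q_def u_def v_def prod.insert sum.insert not_False_eq_True)
    show ?case
      using DERIV_mult[OF 1 2] insert.hyps unfolding eq by simp
  qed simp
  thus ?thesis by (rule DERIV_imp_deriv)
qed

text \<open>Each summand \<open>w/(w - x)\<close>, \<open>x > 0\<close>, of the logarithmic derivative of the finite products maps
  the upper half plane to the lower one. Keeping the summand of a single zero \<open>r\<close> gives a bound
  that survives the limit and, being uniform near the real axis, also yields simplicity of zeros
  in the next lemma.\<close>
lemma Im_log_deriv_ps:
  assumes c: "sq_fact_bounded c" "c 0 = 1" and rs: "real_simple_zeros (power_series c)"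
    and pos: "\<And>x. power_series c (of_real x) = 0 \<Longrightarrow> x > 0"
    and r: "power_series c (of_real r) = 0" and w: "Im w \<noteq> 0"
  shows "Im (w * deriv (power_series c) w / power_series c w) / Im w \<le> - r / (norm (of_real r - w))\<^sup>2"
proof -
  let ?Z = "zeros_upto (power_series c)" and ?P = "zero_product (power_series c)"
  have fin: "finite (?Z R)" for R
    by (rule finite_zeros_upto) (auto simp: c holomorphic_ps ps_0)
  have Zreal: "\<exists>x>0. z = of_real x" if "z \<in> ?Z R" for z R
    using that rs pos unfolding zeros_upto_def real_simple_zeros_def by (auto elim!: Reals_cases)
  have wZ: "w \<notin> ?Z R" for R using Zreal[of w R] w by auto
  have fw: "power_series c w \<noteq> 0" using rs w by (auto simp: real_simple_zeros_def complex_is_Real_iff)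
  have summand: "Im (w / (w - of_real x)) / Im w = - x / (norm (of_real x - w))\<^sup>2" for x
  proof -
    have "w - of_real x \<noteq> 0" using w by auto
    hence "w / (w - of_real x) = 1 + of_real x / (w - of_real x)" by (simp add: field_simps)
    moreover have "Im (of_real x / (w - of_real x)) = - x * Im w / (norm (w - of_real x))\<^sup>2"
      by (simp add: Im_divide cmod_power2)
    ultimately have "Im (w / (w - of_real x)) = - x * Im w / (norm (w - of_real x))\<^sup>2" by simp
    thus ?thesis using w by (simp add: norm_minus_commute)
  qed
  have le: "Im (w * deriv (?P R) w / ?P R w) / Im w \<le> - r / (norm (of_real r - w))\<^sup>2"
    if R: "R \<ge> r" for R
  proof -
    have Z0: "0 \<notin> ?Z R" by (simp add: zeros_upto_def ps_0 c)
    have P0: "?P R w \<noteq> 0"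
      unfolding zero_product_def using fin wZ Zreal by (auto simp: divide_eq_1_iff)
    have "deriv (?P R) w = ?P R w * (\<Sum>z\<in>?Z R. 1 / (w - z))"
      unfolding zero_product_def[abs_def]
      by (rule log_deriv_prod) (use fin wZ Z0 in auto)
    hence "w * deriv (?P R) w / ?P R w = (\<Sum>z\<in>?Z R. w / (w - z))"
      using P0 sum_distrib_left[of w "\<lambda>z. 1 / (w - z)" "?Z R"] by simp
    hence "Im (w * deriv (?P R) w / ?P R w) / Im w = (\<Sum>z\<in>?Z R. Im (w / (w - z)) / Im w)"
      by (simp add: sum_divide_distrib)
    also have "\<dots> \<le> (\<Sum>z\<in>{of_real r}. Im (w / (w - z)) / Im w)"
    proof -
      have rZ: "of_real r \<in> ?Z R" using r R pos[of r] by (simp add: zeros_upto_def)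
      have "Im (w / (w - z)) / Im w \<le> 0" if z: "z \<in> ?Z R" for z
        using Zreal[OF z] by (auto simp: summand)
      hence "(\<Sum>z\<in>?Z R - {of_real r}. Im (w / (w - z)) / Im w) \<le> 0" by (intro sum_nonpos) auto
      thus ?thesis using sum.remove[OF fin rZ, of "\<lambda>z. Im (w / (w - z)) / Im w"] by simp
    qed
    also have "\<dots> = - r / (norm (of_real r - w))\<^sup>2" by (simp add: summand)
    finally show ?thesis .
  qed
  have "((\<lambda>R. Im (w * deriv (?P R) w / ?P R w) / Im w) \<longlongrightarrow>
           Im (w * deriv (power_series c) w / power_series c w) / Im w) at_top"
    using tendsto_higher_deriv_zero_product[OF c rs, of 0 w]
      tendsto_higher_deriv_zero_product[OF c rs, of 1 w] fw w
    by (intro tendsto_intros) auto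
  thus ?thesis
    by (rule tendsto_upperbound)
       (use eventually_mono[OF eventually_ge_at_top[of r] le] in auto)
qed

text \<open>The quotient \<open>h/f\<close> by the given power series \<open>f\<close> satisfies \<open>Im (h/f) / Im w < 0\<close> off the real
  axis, so \<open>h\<close> has no nonreal zeros. At a real zero the derivative of \<open>h/f\<close>, taken along the vertical
  direction, is the limit of \<open>Im (h/f) / Im w\<close>; the quantitative bound keeps this limit negative.\<close>
lemma Laguerre_step:
  assumes c: "sq_fact_bounded c" "c 0 = 1" and rs: "real_simple_zeros (power_series c)"
    and pos: "\<And>x. power_series c (of_real x) = 0 \<Longrightarrow> x > 0"
    and r: "power_series c (of_real r) = 0" and AB: "B > 0" "a \<ge> 0"
    and h: "\<And>w. h w = of_real A * power_series c w + of_real B * (w * deriv (power_series c) w) - of_real a * w * power_series c w"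
  shows "real_simple_zeros h"
  unfolding real_simple_zeros_def
proof (intro allI impI)
  have r0: "r > 0" using pos r by blast
  have bound: "Im (h w / power_series c w) / Im w \<le> - B * r / (norm (of_real r - w))\<^sup>2" if w: "Im w \<noteq> 0" for w
  proof -
    have fw: "power_series c w \<noteq> 0" using rs w by (auto simp: real_simple_zeros_def complex_is_Real_iff)
    have "h w / power_series c w = of_real A + of_real B * (w * deriv (power_series c) w / power_series c w) - of_real a * w"
      using fw by (simp add: h field_simps)
    hence "Im (h w / power_series c w) / Im w = B * (Im (w * deriv (power_series c) w / power_series c w) / Im w) - a"
    proof -
      have "Im (of_real B * u) = B * Im u" for u by simp
      thus ?thesis using w \<open>h w / power_series c w = _\<close> 
        by (simp only: plus_complex.simps minus_complex.simps Im_complex_of_real) (simp add: diff_divide_distrib)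
    qed
    also have "\<dots> \<le> B * (- r / (norm (of_real r - w))\<^sup>2)"
      using mult_left_mono[OF Im_log_deriv_ps[OF c rs pos r w], of B] AB by linarith
    finally show ?thesis by simp
  qed
  fix z assume hz: "h z = 0"
  have "Im z = 0"
  proof (rule ccontr)
    assume nz: "Im z \<noteq> 0"
    hence "norm (of_real r - z) > 0" by auto
    hence "B * r / (norm (of_real r - z))\<^sup>2 > 0" using AB r0 by simp
    thus False using bound[OF nz] hz by simp
  qed
  then obtain x where x: "z = of_real x" by (metis complex_is_Real_iff Reals_cases)
  have "deriv h z \<noteq> 0"
  proof
    assume d0: "deriv h z = 0"
    have fz: "power_series c z \<noteq> 0"
    proof
      assume f0: "power_series c z = 0"
      hence "x > 0" "deriv (power_series c) z \<noteq> 0" using pos x rs by (auto simp: real_simple_zeros_def)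
      thus False using hz f0 AB x by (simp add: h)
    qed
    hence xr: "x \<noteq> r" using r x by auto
    have "h holomorphic_on UNIV"
      unfolding h[abs_def] by (intro holomorphic_intros holomorphic_ps c) auto
    hence "(h has_field_derivative 0) (at z)"
      using d0 by (metis UNIV_I holomorphic_derivI open_UNIV)
    hence 1: "((\<lambda>y. (h y - h z) / (y - z)) \<longlongrightarrow> 0) (at z)" by (simp add: has_field_derivative_iff)
    \<comment> \<open>Approach \<open>z\<close> vertically, where the bound on \<open>Im (h/f) / Im w\<close> applies.\<close>
    have path: "((\<lambda>t::real. z + \<i> * of_real t) \<longlongrightarrow> z + \<i> * of_real 0) (at_right 0)"
      by (intro tendsto_intros)
    have 2: "filterlim (\<lambda>t::real. z + \<i> * of_real t) (at z) (at_right 0)"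
      using path by (auto simp: filterlim_at eventually_at_filter)
    have 3: "((\<lambda>t::real. h (z + \<i> * of_real t) / (\<i> * of_real t)) \<longlongrightarrow> 0) (at_right 0)"
      using filterlim_compose[OF 1 2] hz by simp
    have "isCont (power_series c) z" using holomorphic_ps[OF c(1), of UNIV]
      by (metis UNIV_I has_field_derivative_ps[OF c(1)] DERIV_isCont)
    from isCont_tendsto_compose[OF this, of _ "at_right 0"] path
    have 4: "((\<lambda>t::real. power_series c (z + \<i> * of_real t)) \<longlongrightarrow> power_series c z) (at_right 0)" by simp
    have 5: "((\<lambda>t::real. Re (h (z + \<i> * of_real t) / (\<i> * of_real t) / power_series c (z + \<i> * of_real t)))
          \<longlongrightarrow> Re (0 / power_series c z)) (at_right 0)"
      by (intro tendsto_intros 3 4 fz)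
    have 6: "((\<lambda>t::real. - B * r / (norm (of_real r - (z + \<i> * of_real t)))\<^sup>2) \<longlongrightarrow>
          - B * r / (norm (of_real r - (z + \<i> * of_real 0)))\<^sup>2) (at_right 0)"
      by (intro tendsto_intros) (use xr x in auto)
    have "Re (0 / power_series c z) \<le> - B * r / (norm (of_real r - (z + \<i> * of_real 0)))\<^sup>2"
    proof (rule tendsto_le[OF _ 6 5])
      show "\<forall>\<^sub>F t::real in at_right 0. Re (h (z + \<i> * of_real t) / (\<i> * of_real t) / power_series c (z + \<i> * of_real t))
          \<le> - B * r / (norm (of_real r - (z + \<i> * of_real t)))\<^sup>2"
        using eventually_at_right_less[of "0::real"]
      proof eventually_elim
        case (elim t)
        have "Re (h (z + \<i> * of_real t) / (\<i> * of_real t) / power_series c (z + \<i> * of_real t)) =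
              Im (h (z + \<i> * of_real t) / power_series c (z + \<i> * of_real t)) / Im (z + \<i> * of_real t)"
          (is "Re (?a / (\<i> * ?t) / ?b) = _")
        proof -
          have "?a / (\<i> * ?t) / ?b = - \<i> * (?a / ?b) / ?t" by (simp add: divide_inverse mult_ac)
          hence "Re (?a / (\<i> * ?t) / ?b) = Re (- \<i> * (?a / ?b) / ?t)" by (simp only:)
          also have "\<dots> = Im (?a / ?b) / t" unfolding Re_divide_of_real by (simp only: mult_minus_left uminus_complex.simps Re_i_times)
          finally show ?thesis by (simp add: x)
        qed
        thus ?case using bound[of "z + \<i> * of_real t"] elim x by simp
      qed
    qed simp
    moreover have "norm (of_real r - z) > 0" using xr x by auto
    hence "B * r / (norm (of_real r - z))\<^sup>2 > 0" using AB r0 by simp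
    ultimately show False by simp
  qed
  thus "z \<in> \<real> \<and> deriv h z \<noteq> 0" using x by simp
qed

section \<open>Laguerre's theorem for coefficient sequences\<close>
text \<open>Strictly alternating coefficients make the power series positive on the negative axis, so that
  all real zeros are positive.\<close>
definition alternating_real_rooted :: "(nat \<Rightarrow> real) \<Rightarrow> bool" where
  "alternating_real_rooted c \<longleftrightarrow>
     sq_fact_bounded c \<and> c 0 = 1 \<and> (\<forall>n. (-1) ^ n * c n > 0) \<and> real_simple_zeros (power_series c)"

lemma alternating_real_rooted_zero_pos:
  assumes "alternating_real_rooted c" "power_series c (of_real x) = 0"
  shows "x > 0"
  using assms alternating_ps_nonzero[of c x] by (force simp: alternating_real_rooted_def)

lemma infinite_zeros_alternating:
  assumes "alternating_real_rooted c"
  shows "infinite {z. power_series c z = 0}"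
proof -
  have "c n \<noteq> 0" for n
  proof -
    have "(-1) ^ n * c n > 0" using assms by (simp add: alternating_real_rooted_def)
    thus ?thesis by auto
  qed
  thus ?thesis using assms by (intro infinite_zeros_ps) (auto simp: alternating_real_rooted_def)
qed

text \<open>The subtracted shift keeps the alternation because it moves coefficients of the opposite sign
  into place.\<close>
lemma alternating_real_rooted_step:
  assumes c: "alternating_real_rooted c" and AB: "B > 0" "a \<ge> 0"
  shows "alternating_real_rooted (\<lambda>n. (1 + B * real n) * c n - a * shift_coeff c n)"
    (is "alternating_real_rooted ?d")
proof -
  have b: "sq_fact_bounded c" and c0: "c 0 = 1" and alt: "\<And>n. (-1) ^ n * c n > 0"
    and rs: "real_simple_zeros (power_series c)"
    using c by (auto simp: alternating_real_rooted_def)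
  have d_eq: "?d = (\<lambda>n. (c n + B * (real n * c n)) + (- a) * shift_coeff c n)"
    by (simp add: fun_eq_iff algebra_simps)
  note bs = sq_fact_bounded_add sq_fact_bounded_cmult sq_fact_bounded_of_nat_mult
    sq_fact_bounded_shift b
  have bd: "sq_fact_bounded ?d" unfolding d_eq by (intro bs)
  have psd: "power_series ?d w = of_real 1 * power_series c w + of_real B * (w * deriv (power_series c) w) - of_real a * w * power_series c w" for w
  proof -
    have "power_series ?d w = power_series (\<lambda>n. c n + B * (real n * c n)) w + power_series (\<lambda>n. (- a) * shift_coeff c n) w"
      unfolding d_eq by (intro ps_add bs)
    also have "power_series (\<lambda>n. c n + B * (real n * c n)) w = power_series c w + power_series (\<lambda>n. B * (real n * c n)) w"
      by (intro ps_add bs)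
    also have "power_series (\<lambda>n. B * (real n * c n)) w = of_real B * (w * deriv (power_series c) w)"
      unfolding ps_of_nat_mult[OF b, symmetric] by (intro ps_cmult bs)
    also have "power_series (\<lambda>n. (- a) * shift_coeff c n) w = of_real (- a) * (w * power_series c w)"
      unfolding ps_shift[OF b, symmetric] by (intro ps_cmult bs)
    finally show ?thesis by (simp add: mult.assoc)
  qed
  have "(-1) ^ n * ?d n > 0" for n
  proof (cases n)
    case (Suc m)
    have "(-1) ^ n * ?d n = (1 + B * real n) * ((-1) ^ n * c n) + a * ((-1) ^ m * c m)"
      by (simp add: Suc shift_coeff_def algebra_simps)
    moreover have "(1 + B * real n) * ((-1) ^ n * c n) > 0"
      using AB by (intro mult_pos_pos alt add_pos_nonneg) auto
    moreover have "a * ((-1) ^ m * c m) \<ge> 0" by (rule mult_nonneg_nonneg[OF AB(2) less_imp_le[OF alt]])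
    ultimately show ?thesis by linarith
  qed (simp add: shift_coeff_def c0)
  moreover have "real_simple_zeros (power_series ?d)"
  proof -
    obtain z where z: "power_series c z = 0"
      using infinite_zeros_alternating[OF c] not_finite_existsD by blast
    hence "z \<in> \<real>" using rs by (simp add: real_simple_zeros_def)
    then obtain r where "z = of_real r" by (rule Reals_cases)
    thus ?thesis
      using Laguerre_step[OF b c0 rs alternating_real_rooted_zero_pos[OF c] _ AB psd, of r] z by simp
  qed
  ultimately show ?thesis using bd c0 by (simp add: alternating_real_rooted_def shift_coeff_def)
qed

section \<open>Zeros of the Bessel power series\<close>
text \<open>The coefficient form of Bessel's equation \<open>w f'' + (1 + \<mu>) f' + f/4 = 0\<close>, which is solved by
  \<open>f(w) = w\<^sup>-\<^sup>\<mu>\<^sup>/\<^sup>2 J\<^sub>\<mu>(w\<^sup>1\<^sup>/\<^sup>2)\<close>.\<close>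
definition bessel_recurrence :: "real \<Rightarrow> (nat \<Rightarrow> real) \<Rightarrow> bool" where
  "bessel_recurrence \<mu> c \<longleftrightarrow> (\<forall>n. real (Suc n) * (real (Suc n) + \<mu>) * c (Suc n) = - (1/4) * c n)"

text \<open>Differentiation raises the order by one; this makes the induction in \<open>bessel_double_zero\<close> work.\<close>
lemma bessel_recurrence_deriv:
  assumes "bessel_recurrence \<mu> c" shows "bessel_recurrence (\<mu> + 1) (deriv_coeff c)"
  unfolding bessel_recurrence_def deriv_coeff_def
proof
  fix n
  have "real (Suc (Suc n)) * (real (Suc (Suc n)) + \<mu>) * c (Suc (Suc n)) = - (1/4) * c (Suc n)"
    using assms unfolding bessel_recurrence_def by blast
  hence "real (Suc n) * (real (Suc (Suc n)) * (real (Suc (Suc n)) + \<mu>) * c (Suc (Suc n))) =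
        real (Suc n) * (- (1/4) * c (Suc n))" by (simp only:)
  moreover have "real (Suc n) + (\<mu> + 1) = real (Suc (Suc n)) + \<mu>" by simp
  ultimately show "real (Suc n) * (real (Suc n) + (\<mu> + 1)) * (real (Suc (Suc n)) * c (Suc (Suc n))) =
         - (1/4) * (real (Suc n) * c (Suc n))"
    by (simp only: mult_ac)
qed

text \<open>With the Euler operator \<open>\<theta>\<close>, this is \<open>\<theta>(\<theta> + \<mu>) f = - (w/4) f\<close>.\<close>
lemma bessel_ode:
  assumes b: "sq_fact_bounded c" and rec: "bessel_recurrence \<mu> c"
  defines "T \<equiv> power_series (\<lambda>n. real n * c n)"
  shows "w * deriv T w + of_real \<mu> * T w = - (w / 4) * power_series c w"
proof -
  have eq: "(\<lambda>n. real n * (real n * c n) + \<mu> * (real n * c n)) = (\<lambda>n. - (1/4) * shift_coeff c n)"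
  proof
    fix n
    show "real n * (real n * c n) + \<mu> * (real n * c n) = - (1/4) * shift_coeff c n"
    proof (cases n)
      case (Suc m)
      have "real (Suc m) * (real (Suc m) + \<mu>) * c (Suc m) = - (1/4) * c m"
        using rec unfolding bessel_recurrence_def by blast
      thus ?thesis unfolding Suc shift_coeff_def by (simp add: algebra_simps)
    qed (simp add: shift_coeff_def)
  qed
  note bs = sq_fact_bounded_add sq_fact_bounded_cmult sq_fact_bounded_of_nat_mult
    sq_fact_bounded_shift b
  have "w * deriv T w + of_real \<mu> * T w = power_series (\<lambda>n. real n * (real n * c n) + \<mu> * (real n * c n)) w"
    unfolding T_def by (subst ps_add) (auto intro!: bs simp: ps_cmult ps_of_nat_mult[symmetric] bs)
  also have "\<dots> = of_real (- (1/4)) * (w * power_series c w)"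
    unfolding eq by (subst ps_cmult) (auto intro!: bs simp: ps_shift bs)
  finally show ?thesis by simp
qed

lemma bessel_double_zero:
  assumes "sq_fact_bounded c" "bessel_recurrence \<mu> c" "z \<noteq> 0" "power_series c z = 0" "deriv (power_series c) z = 0"
  shows "(deriv ^^ k) (power_series c) z = 0"
  using assms
proof (induction k arbitrary: c \<mu>)
  case (Suc k)
  note b = Suc.prems(1)
  have T: "power_series (\<lambda>n. real n * c n) = (\<lambda>w. w * power_series (deriv_coeff c) w)"
    using ps_of_nat_mult[OF b] deriv_ps[OF b] by auto
  have "((\<lambda>w. w * power_series (deriv_coeff c) w) has_field_derivative
          z * deriv (power_series (deriv_coeff c)) z + 1 * power_series (deriv_coeff c) z) (at z)"
    using DERIV_mult[OF DERIV_ident has_field_derivative_ps[OF sq_fact_bounded_deriv[OF b]]]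
    by (simp add: deriv_ps sq_fact_bounded_deriv[OF b] mult.commute add.commute)
  hence "deriv (power_series (\<lambda>n. real n * c n)) z = z * deriv (power_series (deriv_coeff c)) z + power_series (deriv_coeff c) z"
    unfolding T by (simp add: DERIV_imp_deriv)
  hence "z * (z * deriv (power_series (deriv_coeff c)) z) = 0"
    using bessel_ode[OF Suc.prems(1,2), of z] Suc.prems(4,5) unfolding T by (simp add: deriv_ps[OF b])
  hence "(deriv ^^ k) (power_series (deriv_coeff c)) z = 0"
    using Suc.prems
    by (intro Suc.IH[OF sq_fact_bounded_deriv[OF b] bessel_recurrence_deriv[OF Suc.prems(2)]])
       (auto simp: deriv_ps[OF b])
  thus ?case by (simp add: funpow_Suc_right deriv_ps[OF b] del: funpow.simps)
qed simp

lemma bessel_zeros_simple: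
  assumes "sq_fact_bounded c" "bessel_recurrence \<mu> c" "c 0 = 1" "power_series c z = 0"
  shows "deriv (power_series c) z \<noteq> 0"
proof
  assume d: "deriv (power_series c) z = 0"
  have z: "z \<noteq> 0" using assms(3,4) ps_0[of c] by auto
  have "power_series c 0 = 0"
    by (rule holomorphic_fun_eq_0_on_connected[of "power_series c" UNIV z])
       (use bessel_double_zero[OF assms(1,2) z assms(4) d] in \<open>auto simp: holomorphic_ps assms\<close>)
  thus False using assms(3) ps_0[of c] by simp
qed

text \<open>Lommel's argument: for a zero \<open>z\<close>, the function \<open>u(x) = f(xz)\<close> solves a Sturm-Liouville problem
  on \<open>[0,1]\<close> with eigenvalue \<open>z\<close> up to a constant. The imaginary part of \<open>x\<^sup>\<mu>\<^sup>+\<^sup>1 u'\<close> times the conjugate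
  of \<open>u\<close>, scaled by \<open>- 1 / Im z\<close>, is the function \<open>\<psi>\<close> below. It vanishes at both ends, but has
  derivative \<open>x\<^sup>\<mu> \<bar>u(x)\<bar>\<^sup>2 / 4 \<ge> 0\<close>, which is positive near 0 since \<open>u(0) = 1\<close>.\<close>
lemma bessel_zeros_real:
  assumes b: "sq_fact_bounded c" and rec: "bessel_recurrence \<mu> c" and c0: "c 0 = 1"
    and \<mu>: "\<mu> \<ge> 0" and z: "power_series c z = 0"
  shows "Im z = 0"
proof (rule ccontr)
  assume nz: "Im z \<noteq> 0"
  define T where "T = power_series (\<lambda>n. real n * c n)"
  define \<psi> where "\<psi> = (\<lambda>x::real. x powr (\<mu> + 1) *
      (- Im (z * power_series (deriv_coeff c) (of_real x * z) * cnj (power_series c (of_real x * z))) / Im z))"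
  have T: "T w = w * power_series (deriv_coeff c) w" for w
    unfolding T_def by (simp add: ps_of_nat_mult[OF b] deriv_ps[OF b])
  have cont: "continuous_on UNIV (power_series d)" if "sq_fact_bounded d" for d
    by (rule holomorphic_on_imp_continuous_on[OF holomorphic_ps[OF that]])
  have cont\<psi>: "continuous_on {0..x} \<psi>" for x
    unfolding \<psi>_def
    by (intro continuous_intros continuous_on_powr' continuous_on_compose2[OF cont[OF b]]
          continuous_on_compose2[OF cont[OF sq_fact_bounded_deriv[OF b]]])
       (use \<mu> nz in auto)
  have der: "(\<psi> has_real_derivative x powr \<mu> * ((norm (power_series c (of_real x * z)))\<^sup>2 / 4)) (at x)"
    if x: "x > 0" for x
  proof -
    define f where "f = power_series c (of_real x * z)"
    define T' where "T' = deriv T (of_real x * z)"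
    define E where "E = (\<lambda>x::real. T (of_real x * z) * cnj (power_series c (of_real x * z)))"
    define D where "D = T (of_real x * z) * cnj (z * power_series (deriv_coeff c) (of_real x * z)) + z * T' * cnj f"
    have lin: "((\<lambda>x::real. of_real x * z) has_vector_derivative z) (at x)"
      by (auto intro!: derivative_eq_intros)
    have chain: "((\<lambda>x::real. power_series d (of_real x * z)) has_vector_derivative z * deriv (power_series d) (of_real x * z)) (at x)"
      if "sq_fact_bounded d" for d
      using field_vector_diff_chain_at[OF lin, of "power_series d"] has_field_derivative_ps[OF that]
      by (simp add: o_def deriv_ps[OF that])
    have "(E has_vector_derivative D) (at x)"
      unfolding E_def D_def T'_def T_def f_def
      using has_vector_derivative_mult[OF chain[OF sq_fact_bounded_of_nat_mult[OF b]]
          has_vector_derivative_cnj[OF chain[OF b]]]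
      by (simp add: deriv_ps[OF b] add.commute)
    hence ImE: "((\<lambda>x. Im (E x)) has_real_derivative Im D) (at x)" by (rule has_field_derivative_Im)
    have ode: "of_real x * z * T' = - (of_real x * z / 4) * f - of_real \<mu> * T (of_real x * z)"
      using bessel_ode[OF b rec, of "of_real x * z"] unfolding T'_def f_def T_def by (simp add: algebra_simps)
    have "of_real x * D = T (of_real x * z) * cnj (T (of_real x * z)) + (of_real x * z * T') * cnj f"
      by (simp add: D_def T algebra_simps)
    also have "\<dots> = of_real ((norm (T (of_real x * z)))\<^sup>2) - of_real (x / 4 * (norm f)\<^sup>2) * z - of_real \<mu> * E x"
      unfolding ode E_def f_def of_real_mult complex_norm_square by (simp add: algebra_simps)
    finally have xDc: "of_real x * D = of_real ((norm (T (of_real x * z)))\<^sup>2) - of_real (x / 4 * (norm f)\<^sup>2) * z - of_real \<mu> * E x" .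
    have xD: "x * Im D = - (x / 4 * (norm f)\<^sup>2) * Im z - \<mu> * Im (E x)"
    proof -
      have Im_scale: "Im (of_real r * u) = r * Im u" for r u by simp
      have "x * Im D = Im (of_real x * D)" by (simp only: Im_scale)
      thus ?thesis
        unfolding xDc by (simp only: minus_complex.simps Im_scale Im_complex_of_real) simp
    qed
    have powr1: "x powr \<mu> = x * x powr (\<mu> - 1)" using x by (simp add: powr_diff)
    have "((\<lambda>x. x powr \<mu> * (- Im (E x) / Im z)) has_real_derivative
            x powr \<mu> * (- Im D / Im z) + \<mu> * x powr (\<mu> - 1) * (- Im (E x) / Im z)) (at x)"
      using DERIV_mult[OF has_real_derivative_powr[OF x, of \<mu>] DERIV_cdivide[OF DERIV_minus[OF ImE], of "Im z"]]
      by (simp add: mult.commute add.commute)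
    also have "x powr \<mu> * (- Im D / Im z) + \<mu> * x powr (\<mu> - 1) * (- Im (E x) / Im z) =
        x powr (\<mu> - 1) * (- (x * Im D + \<mu> * Im (E x)) / Im z)"
    proof -
      have "x * p * (- D' / i) + m * p * (- e / i) = p * (- (x * D' + m * e) / i)" for p D' i m e :: real
        by (cases "i = 0") (simp_all add: divide_simps, simp add: algebra_simps)
      thus ?thesis unfolding powr1 .
    qed
    also have "\<dots> = x powr \<mu> * ((norm f)\<^sup>2 / 4)"
      unfolding powr1 xD using nz by simp
    finally have 1: "((\<lambda>x. x powr \<mu> * (- Im (E x) / Im z)) has_real_derivative
        x powr \<mu> * ((norm f)\<^sup>2 / 4)) (at x)" .
    have 2: "y powr \<mu> * (- Im (E y) / Im z) = \<psi> y" if y: "y \<in> {0<..}" for y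
    proof -
      have "E y = of_real y * (z * power_series (deriv_coeff c) (of_real y * z) * cnj (power_series c (of_real y * z)))"
        by (simp add: E_def T mult_ac)
      moreover have "Im (of_real y * u) = y * Im u" for u by simp
      ultimately have "Im (E y) = y * Im (z * power_series (deriv_coeff c) (of_real y * z) * cnj (power_series c (of_real y * z)))"
        by (simp only:)
      thus ?thesis using y unfolding \<psi>_def by (simp add: powr_add del: times_complex.simps)
    qed
    show ?thesis unfolding f_def[symmetric]
      by (rule has_field_derivative_transform_within_open[OF 1, of "{0<..}"]) (use x 2 in auto)
  qed
  have "isCont (\<lambda>x::real. power_series c (of_real x * z)) 0"
    by (intro isCont_o2[OF _ DERIV_isCont[OF has_field_derivative_ps[OF b]]] continuous_intros)
  hence "((\<lambda>x::real. power_series c (of_real x * z)) \<longlongrightarrow> 1) (at 0)"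
    using c0 ps_0[of c] by (simp add: isCont_def)
  from tendsto_imp_eventually_ne[OF this, of 0]
  obtain d where d: "d > 0" "\<And>x::real. x \<noteq> 0 \<Longrightarrow> \<bar>x\<bar> < d \<Longrightarrow> power_series c (of_real x * z) \<noteq> 0"
    by (auto simp: eventually_at dist_real_def)
  define e where "e = min 1 d / 2"
  have e: "e > 0" "e < d" "e \<le> 1" using d by (auto simp: e_def)
  have "\<psi> 0 < \<psi> e"
  proof (rule DERIV_pos_imp_increasing_open[OF e(1) _ cont\<psi>])
    fix x assume x: "0 < x" "x < e"
    have "x powr \<mu> * ((norm (power_series c (of_real x * z)))\<^sup>2 / 4) > 0"
      using x e d(2)[of x] by (intro mult_pos_pos) auto
    thus "\<exists>y. (\<psi> has_real_derivative y) (at x) \<and> 0 < y" using der[OF x(1)] by blast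
  qed
  also have "\<psi> e \<le> \<psi> 1"
  proof (rule DERIV_nonneg_imp_nondecreasing[OF e(3)])
    fix x assume "e \<le> x" "x \<le> 1"
    hence "x > 0" using e(1) by linarith
    moreover have "0 \<le> x powr \<mu> * ((norm (power_series c (of_real x * z)))\<^sup>2 / 4)" by simp
    ultimately show "\<exists>y. (\<psi> has_real_derivative y) (at x) \<and> 0 \<le> y" using der by blast
  qed
  also have "\<psi> 1 = \<psi> 0" using z \<mu> by (simp add: \<psi>_def)
  finally show False by simp
qed

section \<open>The power series of \<open>N\<^sub>\<nu>\<close>\<close>
definition bessel_coeff :: "real \<Rightarrow> nat \<Rightarrow> real" where
  "bessel_coeff \<nu> n = (-1) ^ n / (fact n * pochhammer (\<nu> + 1) n * 4 ^ n)"

lemma sq_fact_bounded_bessel: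
  assumes "\<nu> \<ge> 0" shows "sq_fact_bounded (bessel_coeff \<nu>)"
proof -
  have ge: "fact n \<le> pochhammer (\<nu> + 1) n" for n
  proof (induction n)
    case (Suc n)
    have "fact (Suc n) = fact n * (1 + real n)" by (simp add: algebra_simps)
    also have "\<dots> \<le> pochhammer (\<nu> + 1) n * (\<nu> + 1 + real n)"
      using assms by (intro mult_mono Suc pochhammer_nonneg) auto
    finally show ?case by (simp add: pochhammer_Suc)
  qed simp
  have "\<bar>bessel_coeff \<nu> n\<bar> \<le> 1 * 1 ^ n / (fact n)\<^sup>2" for n
  proof -
    have pos: "pochhammer (\<nu> + 1) n > 0" using assms by (intro pochhammer_pos) simp
    have "fact n * fact n \<le> fact n * pochhammer (\<nu> + 1) n"
      by (rule mult_left_mono[OF ge]) simp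
    also have "\<dots> \<le> fact n * pochhammer (\<nu> + 1) n * 4 ^ n"
      using mult_left_mono[of 1 "4 ^ n" "fact n * pochhammer (\<nu> + 1) n"] pos by simp
    finally have "(fact n)\<^sup>2 \<le> fact n * pochhammer (\<nu> + 1) n * 4 ^ n"
      by (simp only: power2_eq_square)
    hence "1 / (fact n * pochhammer (\<nu> + 1) n * 4 ^ n) \<le> 1 / (fact n)\<^sup>2"
      by (intro divide_left_mono) (use pos in auto)
    thus ?thesis using pos by (simp add: bessel_coeff_def abs_mult)
  qed
  thus ?thesis unfolding sq_fact_bounded_def by blast
qed

lemma bessel_recurrence_bessel:
  assumes "\<nu> \<ge> 0" shows "bessel_recurrence \<nu> (bessel_coeff \<nu>)"
  unfolding bessel_recurrence_def
proof
  fix n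
  define m where "m = real (Suc n) * (\<nu> + 1 + real n)"
  have "m \<noteq> 0" using assms by (auto simp: m_def)
  have "bessel_coeff \<nu> (Suc n) = - bessel_coeff \<nu> n / (m * 4)"
    by (simp add: bessel_coeff_def pochhammer_Suc m_def mult_ac del: of_nat_Suc)
  moreover have "real (Suc n) * (real (Suc n) + \<nu>) = m" by (simp add: m_def)
  ultimately show "real (Suc n) * (real (Suc n) + \<nu>) * bessel_coeff \<nu> (Suc n) = - (1 / 4) * bessel_coeff \<nu> n"
    using \<open>m \<noteq> 0\<close> by simp
qed

lemma alternating_real_rooted_bessel:
  assumes "\<nu> \<ge> 0" shows "alternating_real_rooted (bessel_coeff \<nu>)"
proof -
  note b = sq_fact_bounded_bessel[OF assms] and r = bessel_recurrence_bessel[OF assms]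
  have 0: "bessel_coeff \<nu> 0 = 1" by (simp add: bessel_coeff_def)
  have "(-1) ^ n * bessel_coeff \<nu> n > 0" for n
  proof -
    have "pochhammer (\<nu> + 1) n > 0" using assms by (intro pochhammer_pos) simp
    thus ?thesis by (simp add: bessel_coeff_def flip: power_add)
  qed
  thus ?thesis
    using b 0 bessel_zeros_real[OF b r 0 assms] bessel_zeros_simple[OF b r 0]
    by (simp add: alternating_real_rooted_def real_simple_zeros_def complex_is_Real_iff)
qed

definition N_coeff :: "real \<Rightarrow> real \<Rightarrow> real \<Rightarrow> real \<Rightarrow> nat \<Rightarrow> real" where
  "N_coeff a b c \<nu> n = Q a b c (2 * real n + \<nu>) / Q a b c \<nu> * bessel_coeff \<nu> n"

lemma roots_below_order:
  assumes "(c = 0 \<and> a \<noteq> b) \<or> (c > 0 \<and> a < b)" "\<nu> \<ge> max_0_nu0 a b c" "Q a b c \<nu> \<noteq> 0"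
  shows "\<nu> \<ge> 0" and "\<And>\<rho>. Q a b c \<rho> = 0 \<Longrightarrow> \<rho> < \<nu>"
proof -
  show "\<nu> \<ge> 0" using assms(2) by (auto simp: max_0_nu0_def split: if_splits)
  fix \<rho> assume \<rho>: "Q a b c \<rho> = 0"
  have Q_poly: "Q a b c x = poly [:c, b - a, a:] x" for x by (simp add: Q_def algebra_simps)
  have "[:c, b - a, a:] \<noteq> 0" using assms(1) by auto
  hence "finite {x. Q a b c x = 0}" unfolding Q_poly by (rule poly_roots_finite)
  hence "\<rho> \<le> Max {x. Q a b c x = 0}" using \<rho> by (intro Max_ge) auto
  also have "\<dots> \<le> \<nu>" using assms(2) \<rho> by (auto simp: max_0_nu0_def split: if_splits)
  finally show "\<rho> < \<nu>" using \<rho> assms(3) by (cases "\<rho> = \<nu>") auto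
qed

text \<open>Applied to the Bessel series, the polynomial \<open>Q(2n+\<nu>) = 4a n(n+\<nu>) + 2(b-a) n + Q(\<nu>)\<close> in the index
  can be treated in two ways. The recurrence turns \<open>n(n+\<nu>)\<close> into a shift, and one Laguerre step
  suffices provided that \<open>(b-a)/Q(\<nu>) > 0\<close> and \<open>a/Q(\<nu>) \<ge> 0\<close>; this includes all cases in which \<open>Q\<close>
  has nonreal roots. In the other cases \<open>Q\<close> has two real roots, and one step per root is made.\<close>
lemma alternating_real_rooted_N:
  assumes abc: "(c = 0 \<and> a \<noteq> b) \<or> (c > 0 \<and> a < b)" and \<nu>: "\<nu> \<ge> max_0_nu0 a b c"
    and Q0: "Q a b c \<nu> \<noteq> 0"
  shows "alternating_real_rooted (N_coeff a b c \<nu>)"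
proof -
  let ?q = "Q a b c \<nu>"
  note nu0 = roots_below_order(1)[OF assms] and below = roots_below_order(2)[OF assms]
  note B = alternating_real_rooted_bessel[OF nu0]
  have rec: "real n * (real n + \<nu>) * bessel_coeff \<nu> n = - (1/4) * shift_coeff (bessel_coeff \<nu>) n" for n
    using bessel_recurrence_bessel[OF nu0, unfolded bessel_recurrence_def, rule_format, of "n - 1"]
    by (cases n) (simp_all only: shift_coeff_def, simp_all)
  have one_step: "alternating_real_rooted (N_coeff a b c \<nu>)"
    if "2 * (b - a) / ?q > 0" "a / ?q \<ge> 0"
  proof -
    have "N_coeff a b c \<nu> n = (1 + 2 * (b - a) / ?q * real n) * bessel_coeff \<nu> n
            - a / ?q * shift_coeff (bessel_coeff \<nu>) n" for n
    proof -
      have "Q a b c (2 * real n + \<nu>) = 4 * a * (real n * (real n + \<nu>)) + (?q + 2 * (b - a) * real n)"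
        by (simp add: Q_def algebra_simps)
      hence "N_coeff a b c \<nu> n = (4 * a * (real n * (real n + \<nu>) * bessel_coeff \<nu> n)
          + (?q + 2 * (b - a) * real n) * bessel_coeff \<nu> n) / ?q"
        by (simp only: N_coeff_def times_divide_eq_left distrib_right mult.assoc)
      also have "\<dots> = (?q + 2 * (b - a) * real n) / ?q * bessel_coeff \<nu> n - a / ?q * shift_coeff (bessel_coeff \<nu>) n"
      proof -
        have "(4 * a * (- (1/4) * s) + e * j) / q = e / q * j - a / q * s" for s e j q :: real
          by (simp add: diff_divide_distrib)
        thus ?thesis unfolding rec .
      qed
      also have "(?q + 2 * (b - a) * real n) / ?q = 1 + 2 * (b - a) / ?q * real n"
        using Q0 by (simp add: add_divide_distrib)
      finally show ?thesis .
    qed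
    hence "N_coeff a b c \<nu> = (\<lambda>n. (1 + 2 * (b - a) / ?q * real n) * bessel_coeff \<nu> n
            - a / ?q * shift_coeff (bessel_coeff \<nu>) n)" by (rule ext)
    thus ?thesis using alternating_real_rooted_step[OF B that] by (simp only:)
  qed
  have two_steps: "alternating_real_rooted (N_coeff a b c \<nu>)"
    if fac: "\<And>x. Q a b c x = a * (x - \<rho>) * (x - \<sigma>)" for \<rho> \<sigma>
  proof -
    \<comment> \<open>The linear factors of \<open>Q(2n+\<nu>)\<close>, normalised to be 1 at \<open>n = 0\<close>.\<close>
    define r s where "r = 2 / (\<nu> - \<rho>)" and "s = 2 / (\<nu> - \<sigma>)"
    have lt: "\<rho> < \<nu>" "\<sigma> < \<nu>" using below[of \<rho>] below[of \<sigma>] fac by auto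
    have a0: "a \<noteq> 0" using fac Q0 by auto
    have rs: "r > 0" "s > 0" using lt by (auto simp: r_def s_def)
    have "N_coeff a b c \<nu> n = (1 + s * real n) * ((1 + r * real n) * bessel_coeff \<nu> n)" for n
    proof -
      have "2 * real n + \<nu> - \<rho> = (1 + r * real n) * (\<nu> - \<rho>)" "2 * real n + \<nu> - \<sigma> = (1 + s * real n) * (\<nu> - \<sigma>)"
        using lt by (simp_all add: r_def s_def field_simps)
      thus ?thesis unfolding N_coeff_def fac using lt a0 by simp
    qed
    hence "N_coeff a b c \<nu> = (\<lambda>n. (1 + s * real n) * ((1 + r * real n) * bessel_coeff \<nu> n))" by (rule ext)
    moreover have "alternating_real_rooted (\<lambda>n. (1 + s * real n) * ((1 + r * real n) * bessel_coeff \<nu> n))"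
      using alternating_real_rooted_step[OF alternating_real_rooted_step[OF B rs(1) order_refl] rs(2) order_refl]
      by simp
    ultimately show ?thesis by (simp only:)
  qed
  consider "a \<ge> 0" "a < b" | "a = 0" "b < 0" "c = 0" | "a \<noteq> 0" "c = 0" | "a < 0" "c > 0"
    using abc by fastforce
  thus ?thesis
  proof cases
    case 1
    have "c \<ge> 0" using abc by auto
    have "?q = a * \<nu>\<^sup>2 + (b - a) * \<nu> + c" by (simp add: Q_def power2_eq_square algebra_simps)
    also have "\<dots> \<ge> 0" using 1 nu0 \<open>c \<ge> 0\<close> by (intro add_nonneg_nonneg mult_nonneg_nonneg) auto
    finally have "?q > 0" using Q0 by simp
    thus ?thesis using 1 by (intro one_step) auto
  next
    case 2
    have "?q = b * \<nu>" by (simp add: Q_def 2)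
    moreover have "\<nu> > 0" using calculation nu0 Q0 by auto
    ultimately have "2 * (b - a) / ?q = 2 / \<nu>" using 2 by simp
    thus ?thesis using \<open>\<nu> > 0\<close> 2 by (intro one_step) auto
  next
    case 3
    show ?thesis
      by (rule two_steps[of 0 "(a - b) / a"]) (use 3 in \<open>simp add: Q_def field_simps\<close>)
  next
    case 4
    define s where "s = sqrt ((b - a)\<^sup>2 - 4 * a * c)"
    have "a * c < 0" using 4 by (simp add: mult_neg_pos)
    hence "(b - a)\<^sup>2 - 4 * a * c \<ge> 0" using zero_le_power2[of "b - a"] by linarith
    hence s: "s * s = (b - a)\<^sup>2 - 4 * a * c" unfolding s_def by simp
    show ?thesis
    proof (rule two_steps[of "(a - b + s) / (2 * a)" "(a - b - s) / (2 * a)"])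
      fix x
      have "a * (x - (a - b + s) / (2 * a)) * (x - (a - b - s) / (2 * a)) =
            ((2 * a * x - (a - b)) * (2 * a * x - (a - b)) - s * s) / (4 * a)"
        using 4 by (simp add: field_simps)
      also have "\<dots> = Q a b c x"
        unfolding s Q_def power2_eq_square using 4 by (simp add: field_simps)
      finally show "Q a b c x = a * (x - (a - b + s) / (2 * a)) * (x - (a - b - s) / (2 * a))" by simp
    qed
  qed
qed

lemma Bessel_J_halfplane:
  assumes \<nu>: "\<nu> \<ge> 0" and z: "z \<noteq> 0"
  shows "Bessel_J \<nu> z = inverse (Gamma (of_real \<nu> + 1)) * ((z / 2) powr of_real \<nu> * power_series (bessel_coeff \<nu>) (z\<^sup>2))"
proof -
  have nonpos: "of_real \<nu> + 1 \<notin> (\<int>\<^sub>\<le>\<^sub>0 :: complex set)"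
  proof
    assume "of_real \<nu> + 1 \<in> (\<int>\<^sub>\<le>\<^sub>0 :: complex set)"
    hence "complex_of_real (\<nu> + 1) \<in> \<int>\<^sub>\<le>\<^sub>0" by simp
    hence "\<nu> + 1 \<in> \<int>\<^sub>\<le>\<^sub>0" by (simp only: of_real_in_nonpos_Ints_iff)
    hence "\<nu> + 1 \<le> 0" by (rule nonpos_Ints_nonpos)
    thus False using \<nu> by simp
  qed
  have G0: "Gamma (of_real \<nu> + 1 :: complex) \<noteq> 0" using nonpos by (simp add: Gamma_eq_zero_iff)
  have summand: "(-1) ^ n / (fact n * Gamma (of_nat n + of_real \<nu> + 1)) * (z / 2) powr (2 * of_nat n + of_real \<nu>) =
      inverse (Gamma (of_real \<nu> + 1)) * (z / 2) powr of_real \<nu> * (of_real (bessel_coeff \<nu> n) * (z\<^sup>2) ^ n)" for n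
  proof -
    have "pochhammer (of_real \<nu> + 1 :: complex) n = Gamma (of_real \<nu> + 1 + of_nat n) / Gamma (of_real \<nu> + 1)"
      by (rule pochhammer_Gamma[OF nonpos])
    hence 1: "Gamma (of_nat n + of_real \<nu> + 1 :: complex) = of_real (pochhammer (\<nu> + 1) n) * Gamma (of_real \<nu> + 1)"
      using G0 pochhammer_of_real[of "\<nu> + 1" n, where ?'a = complex] by (simp add: add_ac divide_eq_eq)
    have "(z / 2) powr (2 * of_nat n + of_real \<nu>) = (z / 2) powr of_nat (2 * n) * (z / 2) powr of_real \<nu>"
      by (simp add: powr_add)
    also have "(z / 2) powr of_nat (2 * n) = (z / 2) ^ (2 * n)" using z by (intro powr_nat') auto
    also have "\<dots> = (z\<^sup>2) ^ n / 4 ^ n" by (simp add: power_mult power_divide)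
    finally have 2: "(z / 2) powr (2 * of_nat n + of_real \<nu>) = (z\<^sup>2) ^ n / 4 ^ n * (z / 2) powr of_real \<nu>" .
    have 3: "complex_of_real (bessel_coeff \<nu> n) = (-1) ^ n / (fact n * of_real (pochhammer (\<nu> + 1) n) * 4 ^ n)"
      by (simp add: bessel_coeff_def)
    have "A / (F * (P * G)) * (Y / R * V) = inverse G * V * (A / (F * P * R) * Y)"
      for A F P G Y R V :: complex by (simp add: divide_inverse)
    thus ?thesis unfolding 1 2 3 .
  qed
  have "(\<lambda>n. inverse (Gamma (of_real \<nu> + 1)) * (z / 2) powr of_real \<nu> * (of_real (bessel_coeff \<nu> n) * (z\<^sup>2) ^ n))
      sums (inverse (Gamma (of_real \<nu> + 1)) * (z / 2) powr of_real \<nu> * power_series (bessel_coeff \<nu>) (z\<^sup>2))"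
    by (intro sums_mult ps_sums sq_fact_bounded_bessel \<nu>)
  from sums_unique[OF this] show ?thesis
    unfolding Bessel_J_def summand by (simp only: mult.assoc)
qed

lemma sq_fact_bounded_affine:
  assumes "sq_fact_bounded c" shows "sq_fact_bounded (\<lambda>n. (2 * real n + \<nu>) * c n)"
proof -
  have "(\<lambda>n. (2 * real n + \<nu>) * c n) = (\<lambda>n. 2 * (real n * c n) + \<nu> * c n)"
    by (simp add: fun_eq_iff algebra_simps)
  thus ?thesis using assms
    by (simp add: sq_fact_bounded_add sq_fact_bounded_cmult sq_fact_bounded_of_nat_mult)
qed

lemma has_field_derivative_powr_ps:
  fixes K :: complex and \<nu> :: real
  assumes b: "sq_fact_bounded c" and z: "Re z > 0"
  defines "W \<equiv> \<lambda>c z. K * ((z / 2) powr of_real \<nu> * power_series c (z\<^sup>2))"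
  shows "(W c has_field_derivative W (\<lambda>n. (2 * real n + \<nu>) * c n) z / z) (at z)"
proof -
  have z0: "z \<noteq> 0" using z by auto
  have nonneg: "z / 2 \<notin> \<real>\<^sub>\<le>\<^sub>0" using z by (auto simp: complex_nonpos_Reals_iff)
  have 1: "((\<lambda>z. (z / 2) powr of_real \<nu>) has_field_derivative of_real \<nu> * (z / 2) powr (of_real \<nu> - 1) * (1/2)) (at z)"
    by (rule DERIV_chain2[where f = "\<lambda>z. z powr of_real \<nu>" and g = "\<lambda>z. z / 2",
          OF has_field_derivative_powr[OF nonneg]])
       (auto intro!: derivative_eq_intros)
  have 2: "((\<lambda>z. power_series c (z\<^sup>2)) has_field_derivative deriv (power_series c) (z\<^sup>2) * (2 * z)) (at z)"
    unfolding deriv_ps[OF b]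
    by (rule DERIV_chain2[OF has_field_derivative_ps[OF b]]) (auto intro!: derivative_eq_intros)
  have "power_series (\<lambda>n. (2 * real n + \<nu>) * c n) (z\<^sup>2) = power_series (\<lambda>n. 2 * (real n * c n) + \<nu> * c n) (z\<^sup>2)"
    by (simp add: algebra_simps)
  also have "\<dots> = 2 * (z\<^sup>2 * deriv (power_series c) (z\<^sup>2)) + of_real \<nu> * power_series c (z\<^sup>2)"
    using b by (subst ps_add)
      (auto simp: ps_cmult ps_of_nat_mult sq_fact_bounded_cmult sq_fact_bounded_of_nat_mult)
  finally have 3: "power_series (\<lambda>n. (2 * real n + \<nu>) * c n) (z\<^sup>2) =
      2 * (z\<^sup>2 * deriv (power_series c) (z\<^sup>2)) + of_real \<nu> * power_series c (z\<^sup>2)" .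
  have 4: "(z / 2) powr (of_real \<nu> - 1) = (z / 2) powr of_real \<nu> * (2 / z)"
    using z0 by (simp add: powr_diff)
  show ?thesis
    unfolding W_def 3
    by (rule DERIV_cong[OF DERIV_cmult[OF DERIV_mult[OF 1 2]]])
       (use z0 in \<open>simp add: 4 field_simps power2_eq_square\<close>)
qed

text \<open>On functions \<open>z\<^sup>\<nu> g(z\<^sup>2)\<close> the operator \<open>z d/dz\<close> multiplies the \<open>n\<close>-th coefficient of \<open>g\<close> by
  \<open>2n+\<nu>\<close>, hence \<open>a z\<^sup>2 d\<^sup>2/dz\<^sup>2 + b z d/dz + c\<close> multiplies it by \<open>Q(2n+\<nu>)\<close>. The right half plane
  avoids the branch cut of the power and the singular convention at 0.\<close>
lemma Bessel_N_eq:
  assumes \<nu>: "\<nu> \<ge> 0" and Q0: "Q a b c \<nu> \<noteq> 0" and z: "Re z > 0"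
  shows "Bessel_N a b c \<nu> z =
    of_real (Q a b c \<nu>) * inverse (Gamma (of_real \<nu> + 1)) * ((z / 2) powr of_real \<nu> * power_series (N_coeff a b c \<nu>) (z\<^sup>2))"
proof -
  define K where "K = inverse (Gamma (complex_of_real \<nu> + 1))"
  define W where "W = (\<lambda>c z. K * ((z / 2) powr of_real \<nu> * power_series c (z\<^sup>2)))"
  define H where "H = {z. Re z > 0}"
  have H: "open H" unfolding H_def by (rule open_halfspace_Re_gt)
  let ?\<theta> = "\<lambda>c n. (2 * real n + \<nu>) * c n"
  let ?j = "bessel_coeff \<nu>"
  note bj = sq_fact_bounded_bessel[OF \<nu>]
  have J: "Bessel_J \<nu> z = W ?j z" if "z \<in> H" for z
    unfolding W_def K_def by (rule Bessel_J_halfplane[OF \<nu>]) (use that in \<open>auto simp: H_def\<close>)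
  have W': "(W c has_field_derivative W (?\<theta> c) z / z) (at z)" if "sq_fact_bounded c" "z \<in> H" for c z
    unfolding W_def using that by (intro has_field_derivative_powr_ps) (auto simp: H_def)
  have J': "deriv (Bessel_J \<nu>) z = W (?\<theta> ?j) z / z" if "z \<in> H" for z
    by (rule DERIV_imp_deriv, rule has_field_derivative_transform_within_open[OF W'[OF bj that] H that])
       (simp add: J)
  have zH: "z \<in> H" using z by (simp add: H_def)
  have z0: "z \<noteq> 0" using z by auto
  have "((\<lambda>z. W (?\<theta> ?j) z / z) has_field_derivative
      (W (?\<theta> (?\<theta> ?j)) z / z * z - W (?\<theta> ?j) z * 1) / (z * z)) (at z)"
    by (intro DERIV_divide W' sq_fact_bounded_affine bj zH DERIV_ident z0)
  hence "deriv (deriv (Bessel_J \<nu>)) z = (W (?\<theta> (?\<theta> ?j)) z / z * z - W (?\<theta> ?j) z * 1) / (z * z)"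
    by (intro DERIV_imp_deriv, rule has_field_derivative_transform_within_open[OF _ H zH]) (simp add: J')
  hence J'': "z ^ 2 * deriv (deriv (Bessel_J \<nu>)) z = W (?\<theta> (?\<theta> ?j)) z - W (?\<theta> ?j) z"
    using z0 by (simp add: power2_eq_square)
  have bs: "sq_fact_bounded (\<lambda>n. k * ?\<theta> ?j n)" "sq_fact_bounded (\<lambda>n. k * ?\<theta> (?\<theta> ?j) n)" "sq_fact_bounded (\<lambda>n. k * ?j n)" for k
    by (intro sq_fact_bounded_cmult sq_fact_bounded_affine bj)+
  have Nc: "of_real (Q a b c \<nu>) * power_series (N_coeff a b c \<nu>) w =
        of_real a * power_series (?\<theta> (?\<theta> ?j)) w + of_real (b - a) * power_series (?\<theta> ?j) w + of_real c * power_series ?j w" for w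
  proof -
    have eq: "N_coeff a b c \<nu> = (\<lambda>n. inverse (Q a b c \<nu>) * ((a * ?\<theta> (?\<theta> ?j) n + (b - a) * ?\<theta> ?j n) + c * ?j n))"
      unfolding N_coeff_def Q_def[of a b c "2 * real _ + \<nu>"] by (simp add: fun_eq_iff field_simps)
    have "power_series (N_coeff a b c \<nu>) w = of_real (inverse (Q a b c \<nu>)) *
            power_series (\<lambda>n. (a * ?\<theta> (?\<theta> ?j) n + (b - a) * ?\<theta> ?j n) + c * ?j n) w"
      unfolding eq by (intro ps_cmult sq_fact_bounded_add bs)
    also have "power_series (\<lambda>n. (a * ?\<theta> (?\<theta> ?j) n + (b - a) * ?\<theta> ?j n) + c * ?j n) w =
        (power_series (\<lambda>n. a * ?\<theta> (?\<theta> ?j) n) w + power_series (\<lambda>n. (b - a) * ?\<theta> ?j n) w) + power_series (\<lambda>n. c * ?j n) w"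
      by (intro trans[OF ps_add] arg_cong2[of _ _ _ _ "(+)"] ps_add refl sq_fact_bounded_add bs)
    also have "power_series (\<lambda>n. a * ?\<theta> (?\<theta> ?j) n) w = of_real a * power_series (?\<theta> (?\<theta> ?j)) w"
      by (intro ps_cmult sq_fact_bounded_affine bj)
    also have "power_series (\<lambda>n. (b - a) * ?\<theta> ?j n) w = of_real (b - a) * power_series (?\<theta> ?j) w"
      by (intro ps_cmult sq_fact_bounded_affine bj)
    also have "power_series (\<lambda>n. c * ?j n) w = of_real c * power_series ?j w"
      by (intro ps_cmult bj)
    finally show ?thesis using Q0 by simp
  qed
  have "Bessel_N a b c \<nu> z = of_real a * (z ^ 2 * deriv (deriv (Bessel_J \<nu>)) z)
      + of_real b * (z * deriv (Bessel_J \<nu>) z) + of_real c * Bessel_J \<nu> z"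
    by (simp add: Bessel_N_def)
  also have "\<dots> = of_real a * W (?\<theta> (?\<theta> ?j)) z + of_real (b - a) * W (?\<theta> ?j) z + of_real c * W ?j z"
    unfolding J'' J'[OF zH] J[OF zH] using z0 by (simp add: algebra_simps)
  also have "\<dots> = K * (z / 2) powr of_real \<nu> * (of_real a * power_series (?\<theta> (?\<theta> ?j)) (z\<^sup>2)
      + of_real (b - a) * power_series (?\<theta> ?j) (z\<^sup>2) + of_real c * power_series ?j (z\<^sup>2))"
    unfolding W_def by (simp only: ring_distribs mult_ac)
  also have "\<dots> = of_real (Q a b c \<nu>) * K * ((z / 2) powr of_real \<nu> * power_series (N_coeff a b c \<nu>) (z\<^sup>2))"
    unfolding Nc[symmetric] by (simp only: mult_ac)
  finally show ?thesis unfolding K_def .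
qed

lemma Bessel_N_zero_iff:
  assumes \<nu>: "\<nu> \<ge> 0" and Q0: "Q a b c \<nu> \<noteq> 0" and x: "x > 0"
  shows "Bessel_N a b c \<nu> (of_real x) = 0 \<longleftrightarrow> power_series (N_coeff a b c \<nu>) (of_real (x\<^sup>2)) = 0"
proof -
  have "complex_of_real \<nu> + 1 \<notin> \<int>\<^sub>\<le>\<^sub>0"
    using \<nu> nonpos_Ints_nonpos[of "\<nu> + 1"] of_real_in_nonpos_Ints_iff[of "\<nu> + 1", where ?'a = complex] by auto
  hence "Gamma (complex_of_real \<nu> + 1) \<noteq> 0" by (simp add: Gamma_eq_zero_iff)
  thus ?thesis using Bessel_N_eq[OF \<nu> Q0, of "of_real x"] x Q0 by simp
qed

section \<open>Symmetric functions of a sequence\<close>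
text \<open>The logarithmic derivative of the product of the \<open>1 - x\<^sub>k X\<close> is minus the generating series of
  the power sums, shifted by one.\<close>
lemma Newton_identity:
  fixes x :: "'b \<Rightarrow> 'a :: field"
  assumes "finite A"
  shows "of_nat n * ((-1) ^ n * esym A x n) =
           - (\<Sum>i=1..n. ((-1) ^ (n - i) * esym A x (n - i)) * (\<Sum>k\<in>A. x k ^ i))"
proof (cases n)
  case (Suc m)
  define P where "P = (\<lambda>A. \<Prod>k\<in>A. 1 - fps_const (x k) * fps_X)"
  define S where "S = (\<lambda>A. Abs_fps (\<lambda>n. \<Sum>k\<in>A. x k ^ Suc n))"
  have "fps_deriv (P A) = - (P A * S A)"
    using assms
  proof (induction A rule: finite_induct)
    case empty
    show ?case by (simp add: P_def S_def fps_eq_iff)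
  next
    case (insert k A)
    define u where "u = 1 - fps_const (x k) * fps_X"
    define g where "g = Abs_fps (\<lambda>n. x k ^ Suc n)"
    have "u * g = fps_const (x k)"
    proof (rule fps_ext)
      fix n
      have "u * g = g - fps_const (x k) * (fps_X * g)" by (simp add: u_def algebra_simps)
      thus "fps_nth (u * g) n = fps_nth (fps_const (x k)) n"
        by (cases n) (simp_all add: g_def)
    qed
    moreover have "fps_deriv u = - fps_const (x k)" by (simp add: u_def)
    ultimately have "fps_deriv u = - (u * g)" by simp
    hence "fps_deriv (u * P A) = - (u * P A * (g + S A))"
      using insert.IH by (simp only: fps_deriv_mult) (simp add: algebra_simps)
    moreover have "P (insert k A) = u * P A" using insert.hyps by (simp add: P_def u_def)
    moreover have "S (insert k A) = g + S A"
      using insert.hyps by (intro fps_ext) (simp add: S_def g_def)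
    ultimately show ?case by simp
  qed
  hence "fps_nth (fps_deriv (P A)) m = - fps_nth (P A * S A) m" by simp
  also have "fps_nth (fps_deriv (P A)) m = of_nat n * ((-1) ^ n * esym A x n)"
    unfolding P_def fps_deriv_nth fps_nth_prod_one_minus[OF assms] Suc by simp
  also have "fps_nth (P A * S A) m = (\<Sum>i\<le>m. ((-1) ^ (m - i) * esym A x (m - i)) * (\<Sum>k\<in>A. x k ^ Suc i))"
    unfolding fps_mult_nth P_def S_def fps_nth_prod_one_minus[OF assms] fps_nth_Abs_fps
    by (rule sum.reindex_bij_witness[of _ "\<lambda>i. m - i" "\<lambda>i. m - i"]) auto
  also have "\<dots> = (\<Sum>i=1..n. ((-1) ^ (n - i) * esym A x (n - i)) * (\<Sum>k\<in>A. x k ^ i))"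
    unfolding Suc by (rule sum.reindex_bij_witness[of _ "\<lambda>i. i - 1" Suc]) auto
  finally show ?thesis .
qed simp

text \<open>By Newton's identities each power sum is a polynomial in the elementary symmetric functions, so
  the partial power sums converge along with those, and the limits satisfy the same identities.\<close>
lemma power_sums_converge:
  fixes e :: "nat \<Rightarrow> real" and x :: "nat \<Rightarrow> real"
  assumes lim: "\<And>n. (\<lambda>K. esym {1..K} x n) \<longlonglongrightarrow> e n" and e0: "e 0 = 1"
  shows "\<exists>p. (\<forall>n\<ge>1. (\<lambda>k. x (k + 1) ^ n) sums p n) \<and>
           (\<forall>n. real n * ((-1) ^ n * e n) = - (\<Sum>i=1..n. ((-1) ^ (n - i) * e (n - i)) * p i))"
proof -
  let ?p = "\<lambda>n K. \<Sum>k=1..K. x k ^ n"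
  have esym0: "esym {1..K} x 0 = 1" for K
  proof -
    have "{T. T \<subseteq> {1..K} \<and> card T = 0} = {{}}"
      using finite_subset[OF _ finite_atLeastAtMost[of 1 K]] by auto
    thus ?thesis by (simp add: esym_def)
  qed
  have conv: "n \<ge> 1 \<Longrightarrow> convergent (?p n)" for n
  proof (induction n rule: less_induct)
    case (less n)
    have set_eq: "{1..n} = insert n {1..<n}" using less.prems by auto
    have "?p n K = - (real n * ((-1) ^ n * esym {1..K} x n)) -
        (\<Sum>i=1..<n. ((-1) ^ (n - i) * esym {1..K} x (n - i)) * ?p i K)" for K
      using Newton_identity[OF finite_atLeastAtMost, of n 1 K x] unfolding set_eq
      by (simp only: sum.insert[OF finite_atLeastLessThan] atLeastLessThan_iff diff_self_eq_0 esym0)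
         (simp add: esym0[unfolded One_nat_def])
    hence "?p n = (\<lambda>K. - (real n * ((-1) ^ n * esym {1..K} x n)) -
        (\<Sum>i=1..<n. ((-1) ^ (n - i) * esym {1..K} x (n - i)) * ?p i K))" by (rule ext)
    moreover have "?p i \<longlonglongrightarrow> lim (?p i)" if "i \<in> {1..<n}" for i
      using less.IH[of i] that by (simp add: convergent_LIMSEQ_iff)
    hence "(\<lambda>K. - (real n * ((-1) ^ n * esym {1..K} x n)) -
        (\<Sum>i=1..<n. ((-1) ^ (n - i) * esym {1..K} x (n - i)) * ?p i K)) \<longlonglongrightarrow>
        - (real n * ((-1) ^ n * e n)) -
        (\<Sum>i=1..<n. ((-1) ^ (n - i) * e (n - i)) * lim (?p i))"
      by (intro tendsto_intros lim)
    ultimately show ?case unfolding convergent_def by metis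
  qed
  define p where "p = (\<lambda>n. lim (?p n))"
  have p: "?p n \<longlonglongrightarrow> p n" if "n \<ge> 1" for n
    using conv[OF that] by (simp add: p_def convergent_LIMSEQ_iff)
  have "(\<lambda>k. x (k + 1) ^ n) sums p n" if "n \<ge> 1" for n
  proof -
    have "(\<Sum>k<K. x (k + 1) ^ n) = ?p n K" for K
      by (rule sum.reindex_bij_witness[of _ "\<lambda>k. k - 1" Suc]) auto
    thus ?thesis using p[OF that] by (simp add: sums_def)
  qed
  moreover have "real n * ((-1) ^ n * e n) = - (\<Sum>i=1..n. ((-1) ^ (n - i) * e (n - i)) * p i)" for n
  proof (rule LIMSEQ_unique)
    show "(\<lambda>K. real n * ((-1) ^ n * esym {1..K} x n)) \<longlonglongrightarrow> real n * ((-1) ^ n * e n)"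
      by (intro tendsto_intros lim)
    show "(\<lambda>K. real n * ((-1) ^ n * esym {1..K} x n)) \<longlonglongrightarrow>
        - (\<Sum>i=1..n. ((-1) ^ (n - i) * e (n - i)) * p i)"
      unfolding Newton_identity[OF finite_atLeastAtMost] by (intro tendsto_intros lim p) auto
  qed
  ultimately show ?thesis by blast
qed

text \<open>Since the terms are nonnegative, the unordered sum is the supremum of the sums over the lists
  with entries in \<open>{1..K}\<close>, and these lists are the enumerated subsets of \<open>{1..K}\<close>.\<close>
lemma has_sum_esym:
  fixes x :: "nat \<Rightarrow> real"
  assumes nonneg: "\<And>k. k \<ge> 1 \<Longrightarrow> x k \<ge> 0" and lim: "(\<lambda>K. esym {1..K} x n) \<longlonglongrightarrow> s"
  shows "((\<lambda>ks. \<Prod>k\<leftarrow>ks. x k) has_sum s)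
           {ks. length ks = n \<and> sorted_wrt (<) ks \<and> (\<forall>k\<in>set ks. 1 \<le> k)}"
proof -
  let ?f = "\<lambda>ks. \<Prod>k\<leftarrow>ks. x k"
  let ?A = "{ks :: nat list. length ks = n \<and> sorted_wrt (<) ks \<and> (\<forall>k\<in>set ks. 1 \<le> k)}"
  define L where "L = (\<lambda>K. {ks \<in> ?A. set ks \<subseteq> {1..K}})"
  have finL: "finite (L K)" for K
    by (rule finite_subset[OF _ finite_lists_length_eq[of "{1..K}" n]]) (auto simp: L_def)
  have sumL: "sum ?f (L K) = esym {1..K} x n" for K
    unfolding esym_def
  proof (rule sum.reindex_bij_witness[of _ sorted_list_of_set set])
    fix ks assume "ks \<in> L K"
    hence ks: "length ks = n" "sorted_wrt (<) ks" "set ks \<subseteq> {1..K}" by (auto simp: L_def)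
    have d: "distinct ks" using ks(2) by (simp add: strict_sorted_iff)
    show "sorted_list_of_set (set ks) = ks"
      using ks(2) by (simp add: strict_sorted_iff sorted_list_of_set.idem_if_sorted_distinct)
    show "set ks \<in> {T. T \<subseteq> {1..K} \<and> card T = n}" using ks d by (simp add: distinct_card)
    show "prod x (set ks) = ?f ks" using d by (simp add: prod.distinct_set_conv_list)
  next
    fix T assume "T \<in> {T. T \<subseteq> {1..K} \<and> card T = n}"
    hence T: "T \<subseteq> {1..K}" "card T = n" "finite T"
      using finite_subset[OF _ finite_atLeastAtMost[of 1 K]] by auto
    show "set (sorted_list_of_set T) = T" using T by simp
    show "sorted_list_of_set T \<in> L K"
      using T by (auto simp: L_def)
  qed
  have fnn: "?f ks \<ge> 0" if "ks \<in> ?A" for ks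
    using that nonneg by (intro prod_list_nonneg) auto
  have mono: "incseq (\<lambda>K. esym {1..K} x n)"
    unfolding incseq_def
  proof (intro allI impI)
    fix K K' :: nat assume "K \<le> K'"
    hence "L K \<subseteq> L K'" by (auto simp: L_def)
    hence "sum ?f (L K) \<le> sum ?f (L K')"
      by (intro sum_mono2 finL) (use fnn in \<open>auto simp: L_def\<close>)
    thus "esym {1..K} x n \<le> esym {1..K'} x n" unfolding sumL .
  qed
  have le: "esym {1..K} x n \<le> s" for K by (rule incseq_le[OF mono lim])
  show ?thesis
    unfolding has_sum_def
  proof (rule order_tendstoI)
    fix a assume "a < s"
    then obtain K where K: "a < sum ?f (L K)"
      using order_tendstoD(1)[OF lim] unfolding sumL by (auto simp: eventually_sequentially)
    show "\<forall>\<^sub>F F in finite_subsets_at_top ?A. a < sum ?f F"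
      unfolding eventually_finite_subsets_at_top
    proof (intro exI[of _ "L K"] conjI allI impI finL)
      show "L K \<subseteq> ?A" by (auto simp: L_def)
      fix F assume F: "finite F \<and> L K \<subseteq> F \<and> F \<subseteq> ?A"
      have "sum ?f (L K) \<le> sum ?f F" by (rule sum_mono2) (use F fnn in blast)+
      thus "a < sum ?f F" using K by linarith
    qed
  next
    fix a assume a: "s < a"
    show "\<forall>\<^sub>F F in finite_subsets_at_top ?A. sum ?f F < a"
      unfolding eventually_finite_subsets_at_top
    proof (intro exI[of _ "{}"] conjI allI impI)
      fix F assume F: "finite F \<and> {} \<subseteq> F \<and> F \<subseteq> ?A"
      define K where "K = Max (insert 0 (\<Union> (set ` F)))"
      have "finite (insert 0 (\<Union> (set ` F)))" using F by auto
      hence "k \<le> K" if "ks \<in> F" "k \<in> set ks" for ks k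
        unfolding K_def using that by (intro Max_ge) auto
      hence "F \<subseteq> L K" using F unfolding L_def by fastforce
      hence "sum ?f F \<le> sum ?f (L K)"
        by (intro sum_mono2 finL) (use fnn in \<open>auto simp: L_def\<close>)
      thus "sum ?f F < a" using le[of K] a unfolding sumL by linarith
    qed auto
  qed
qed

section \<open>Enumeration of the positive zeros\<close>
text \<open>The counting function of a locally finite infinite set of positive reals takes every positive
  integer as value at exactly one element of the set, so the definite description is proper.\<close>
lemma kth_pos_zero_enumerates:
  fixes f :: "complex \<Rightarrow> complex"
  defines "Z \<equiv> {y::real. 0 < y \<and> f (of_real y) = 0}"
  assumes inf: "infinite Z" and fin: "\<And>x. finite {y \<in> Z. y \<le> x}"
  shows kth_pos_zero_in: "k \<ge> 1 \<Longrightarrow> kth_pos_zero f k \<in> Z"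
    and bij_betw_kth_pos_zero:
      "K \<ge> 1 \<Longrightarrow> bij_betw (kth_pos_zero f) {1..K} {y \<in> Z. y \<le> kth_pos_zero f K}"
    and filterlim_kth_pos_zero: "filterlim (kth_pos_zero f) at_top sequentially"
proof -
  define c where "c = (\<lambda>x. card {y \<in> Z. y \<le> x})"
  have c_mono: "c x \<le> c y" if "x \<le> y" for x y
    unfolding c_def by (intro card_mono fin) (use that in auto)
  have c_less: "c x < c y" if "x < y" "y \<in> Z" for x y
  proof -
    have "{z \<in> Z. z \<le> x} \<subseteq> {z \<in> Z. z \<le> y}" "y \<in> {z \<in> Z. z \<le> y}" "y \<notin> {z \<in> Z. z \<le> x}"
      using that by auto
    hence "{z \<in> Z. z \<le> x} \<subset> {z \<in> Z. z \<le> y}" by blast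
    thus ?thesis unfolding c_def by (intro psubset_card_mono fin)
  qed
  have c_inj: "x = y" if "c x = c y" "x \<in> Z" "y \<in> Z" for x y
    using c_less[of x y] c_less[of y x] that by (cases x y rule: linorder_cases) auto
  have c_pos: "c x \<ge> 1" if "x \<in> Z" for x
  proof -
    have "{y \<in> Z. y \<le> x} \<noteq> {}" using that by auto
    thus ?thesis unfolding c_def using fin[of x] by (simp add: Suc_le_eq card_gt_0_iff)
  qed
  have ex: "\<exists>x. c x = k \<and> (k \<ge> 1 \<longrightarrow> x \<in> Z)" for k
  proof (induction k)
    case 0
    have "{y \<in> Z. y \<le> 0} = {}" by (auto simp: Z_def)
    hence "c 0 = 0" unfolding c_def by (simp only: card.empty)
    thus ?case by auto
  next
    case (Suc k)
    then obtain x where x: "c x = k" by blast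
    have "infinite (Z - {y \<in> Z. y \<le> x})" by (rule Diff_infinite_finite[OF fin inf])
    hence "Z - {y \<in> Z. y \<le> x} \<noteq> {}" using finite.emptyI by metis
    then obtain y0 where "y0 \<in> Z - {y \<in> Z. y \<le> x}" by blast
    hence y0: "y0 \<in> Z" "x < y0" by auto
    define T where "T = {y \<in> Z. x < y \<and> y \<le> y0}"
    have T: "finite T" "T \<noteq> {}"
      using y0 finite_subset[OF _ fin[of y0], of T] by (auto simp: T_def)
    define x' where "x' = Min T"
    have x': "x' \<in> Z" "x < x'" "x' \<le> y0" using Min_in[OF T] by (auto simp: x'_def T_def)
    have next_zero: "y = x'" if y: "y \<in> Z" "y \<le> x'" "\<not> y \<le> x" for y
    proof -
      have "y \<in> T" using x' y by (auto simp: T_def)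
      hence "x' \<le> y" using T by (simp add: x'_def)
      thus "y = x'" using y by simp
    qed
    have "{y \<in> Z. y \<le> x'} = insert x' {y \<in> Z. y \<le> x}"
    proof (rule Set.set_eqI)
      fix y show "y \<in> {y \<in> Z. y \<le> x'} \<longleftrightarrow> y \<in> insert x' {y \<in> Z. y \<le> x}"
        using x' next_zero[of y] by (cases "y \<le> x") auto
    qed
    hence "c x' = Suc k" using x x' fin[of x] unfolding c_def by simp
    thus ?case using x' by blast
  qed
  have spec: "kth_pos_zero f k \<in> Z \<and> c (kth_pos_zero f k) = k" if k: "k \<ge> 1" for k
  proof -
    have *: "kth_pos_zero f k = (THE x. x \<in> Z \<and> c x = k)"
      unfolding kth_pos_zero_def c_def Z_def
      by (intro arg_cong[where f = The] ext) (auto intro!: arg_cong[where f = card])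
    obtain x where x: "x \<in> Z \<and> c x = k" using ex[of k] k by blast
    show ?thesis unfolding *
      by (rule theI[of _ x]) (use x c_inj in auto)
  qed
  show "k \<ge> 1 \<Longrightarrow> kth_pos_zero f k \<in> Z" using spec by blast
  show "bij_betw (kth_pos_zero f) {1..K} {y \<in> Z. y \<le> kth_pos_zero f K}" if K: "K \<ge> 1"
    unfolding bij_betw_def
  proof
    show "inj_on (kth_pos_zero f) {1..K}"
      by (rule inj_on_inverseI[of _ c]) (use spec in auto)
    show "kth_pos_zero f ` {1..K} = {y \<in> Z. y \<le> kth_pos_zero f K}"
    proof safe
      fix j assume j: "j \<in> {1..K}"
      thus "kth_pos_zero f j \<in> Z" using spec by auto
      show "kth_pos_zero f j \<le> kth_pos_zero f K"
        using c_less[of "kth_pos_zero f K" "kth_pos_zero f j"] spec[of j] spec[of K] j by fastforce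
    next
      fix y assume y: "y \<in> Z" "y \<le> kth_pos_zero f K"
      have "c y \<le> K" using c_mono[OF y(2)] spec[OF K] by simp
      moreover have "kth_pos_zero f (c y) = y"
        using spec[OF c_pos[OF y(1)]] y(1) c_inj by blast
      ultimately show "y \<in> kth_pos_zero f ` {1..K}"
        using c_pos[OF y(1)] by (intro image_eqI[of _ _ "c y"]) auto
    qed
  qed
  show "filterlim (kth_pos_zero f) at_top sequentially"
    unfolding filterlim_at_top
  proof
    fix X
    show "\<forall>\<^sub>F k in sequentially. X \<le> kth_pos_zero f k"
      using eventually_gt_at_top[of "c X"]
    proof eventually_elim
      case (elim k)
      show ?case
      proof (rule ccontr)
        assume "\<not> X \<le> kth_pos_zero f k"
        hence "c (kth_pos_zero f k) \<le> c X" by (intro c_mono) simp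
        thus False using spec[of k] elim by simp
      qed
    qed
  qed
qed

section \<open>Cramer's rule for a unipotent Toeplitz system\<close>
text \<open>The matrix is the product of the Toeplitz matrix \<open>L\<close> of the system and the identity matrix
  \<open>U\<close> whose last column is replaced by the solution.\<close>
lemma det_Cramer_last_column:
  fixes A s v :: "nat \<Rightarrow> real"
  assumes n: "n \<ge> 1" and A0: "A 0 = 1"
    and rec: "\<And>m. v m = (\<Sum>i=1..m. A (m - i) * s i)"
  shows "Determinant.det (Matrix.mat n n (\<lambda>(i, j). if j + 1 = n then v (i + 1)
            else if i > j then A (i - j) else if i = j then 1 else 0)) = s n"
    (is "Determinant.det ?M = _")
proof -
  define L where "L = Matrix.mat n n (\<lambda>(i, j). if j \<le> i then A (i - j) else 0)"
  define U where "U = Matrix.mat n n (\<lambda>(i, j). if j + 1 = n then s (i + 1) else if i = j then 1 else 0)"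
  have LU: "L \<in> carrier_mat n n" "U \<in> carrier_mat n n" by (simp_all add: L_def U_def)
  have "?M = L * U"
  proof (rule eq_matI)
    fix i j assume "i < dim_row (L * U)" "j < dim_col (L * U)"
    hence ij: "i < n" "j < n" by (simp_all add: L_def U_def)
    have prod: "(L * U) $$ (i, j) = (\<Sum>k<n. L $$ (i, k) * U $$ (k, j))"
      using ij LU by (simp add: scalar_prod_def lessThan_atLeast0 L_def U_def)
    show "?M $$ (i, j) = (L * U) $$ (i, j)"
    proof (cases "j + 1 = n")
      case True
      have "(\<Sum>k<n. L $$ (i, k) * U $$ (k, j)) = (\<Sum>k<n. if k \<le> i then A (i - k) * s (k + 1) else 0)"
        using ij True by (intro sum.cong) (auto simp: L_def U_def)
      also have "\<dots> = (\<Sum>k\<in>{k\<in>{..<n}. k \<le> i}. A (i - k) * s (k + 1))"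
        by (rule sum.inter_filter[symmetric]) simp
      also have "\<dots> = v (i + 1)"
        unfolding rec by (rule sum.reindex_bij_witness[of _ "\<lambda>k. k - 1" Suc]) (use ij in auto)
      finally show ?thesis using ij True prod by simp
    next
      case False
      have "(\<Sum>k<n. L $$ (i, k) * U $$ (k, j)) = (\<Sum>k<n. if k = j then L $$ (i, j) else 0)"
        using ij False by (intro sum.cong) (auto simp: U_def)
      also have "\<dots> = L $$ (i, j)" using ij by simp
      finally show ?thesis using ij False prod A0 by (auto simp: L_def)
    qed
  qed (simp_all add: L_def U_def)
  hence "Determinant.det ?M = Determinant.det L * Determinant.det U" using det_mult[OF LU] by simp
  also have "Determinant.det L = prod_list (diag_mat L)"
    by (rule det_lower_triangular[OF _ LU(1)]) (simp add: L_def)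
  also have "\<dots> = 1" unfolding prod_list_diag_prod by (simp add: L_def A0)
  also have "Determinant.det U = prod_list (diag_mat U)"
    by (rule det_upper_triangular[OF _ LU(2)]) (auto simp: U_def)
  also have "\<dots> = (\<Prod>i<n. if i = n - 1 then s n else 1)"
    unfolding prod_list_diag_prod using n by (intro prod.cong) (auto simp: U_def)
  also have "\<dots> = s n" using n by simp
  finally show ?thesis by simp
qed

section \<open>The Rayleigh sums\<close>
lemma esym_reindex:
  assumes "bij_betw g A B" shows "esym B x n = esym A (\<lambda>k. x (g k)) n"
proof -
  have inj: "inj_on g A" and im: "g ` A = B" using assms by (auto simp: bij_betw_def)
  have "esym A (\<lambda>k. x (g k)) n = esym B x n"
    unfolding esym_def
  proof (rule sum.reindex_bij_witness[of _ "\<lambda>T. inv_into A g ` T" "\<lambda>T. g ` T"])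
    fix T assume T: "T \<in> {T. T \<subseteq> A \<and> card T = n}"
    hence injT: "inj_on g T" using inj_on_subset[OF inj] by blast
    show "inv_into A g ` g ` T = T" using T inj by (intro inv_into_image_cancel) auto
    show "g ` T \<in> {T. T \<subseteq> B \<and> card T = n}" using T im card_image[OF injT] by auto
    show "prod x (g ` T) = (\<Prod>k\<in>T. x (g k))" using injT by (simp add: prod.reindex)
  next
    fix T assume T: "T \<in> {T. T \<subseteq> B \<and> card T = n}"
    hence TB: "T \<subseteq> g ` A" using im by simp
    show "g ` inv_into A g ` T = T" by (rule image_inv_into_cancel[OF refl TB])
    have "card (inv_into A g ` T) = card T" by (rule card_image[OF inj_on_inv_into[OF TB]])
    thus "inv_into A g ` T \<in> {T. T \<subseteq> A \<and> card T = n}"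
      using T TB inv_into_into[of _ g A] by auto
  qed
  thus ?thesis by simp
qed

lemma esym_of_real: "esym A (\<lambda>k. of_real (x k)) n = of_real (esym A x n)"
  by (simp add: esym_def)


theorem mainTheorem5:
  fixes a b c \<nu> :: real and n :: nat
  assumes "(c = 0 \<and> a \<noteq> b) \<or> (c > 0 \<and> a < b)"
    and "\<nu> \<ge> max_0_nu0 a b c"
    and "Q a b c \<nu> \<noteq> 0"
    and "n \<ge> 1"
  shows "((\<lambda>ks. 1 / (\<Prod>k\<leftarrow>ks. (Bessel_N_zero a b c \<nu> k) ^ 2)) has_sum
            (Q a b c (2 * real n + \<nu>) / (fact n * 4 ^ n * pochhammer (\<nu> + 1) n * Q a b c \<nu>)))
            {ks :: nat list. length ks = n \<and> sorted_wrt (<) ks \<and> (\<forall>k\<in>set ks. 1 \<le> k)}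
         \<and> (\<lambda>k. 4 ^ n * (-1) ^ n / (Bessel_N_zero a b c \<nu> (k + 1)) ^ (2 * n)) sums
             Determinant.det (M_matrix a b c \<nu> n)"
proof -
  define d where "d = N_coeff a b c \<nu>"
  define F where "F = power_series d"
  define lam where "lam = Bessel_N_zero a b c \<nu>"
  define x where "x = (\<lambda>k. inverse ((lam k)\<^sup>2))"
  define e where "e = (\<lambda>m. (-1) ^ m * d m)"
  have nu0: "\<nu> \<ge> 0" by (rule roots_below_order(1)[OF assms(1-3)])
  have good: "alternating_real_rooted d"
    unfolding d_def by (rule alternating_real_rooted_N[OF assms(1-3)])
  hence d: "sq_fact_bounded d" "d 0 = 1" "real_simple_zeros F"
    by (auto simp: alternating_real_rooted_def F_def)
  define Z where "Z = {y::real. 0 < y \<and> Bessel_N a b c \<nu> (of_real y) = 0}"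
  have Z_iff: "y \<in> Z \<longleftrightarrow> 0 < y \<and> F (of_real (y\<^sup>2)) = 0" for y
    using Bessel_N_zero_iff[OF nu0 assms(3)] by (auto simp: Z_def F_def d_def)
  have fin_upto: "finite (zeros_upto F R)" for R
    unfolding F_def by (rule finite_zeros_upto) (auto simp: d holomorphic_ps ps_0)
  have zeros_eq: "zeros_upto F (R\<^sup>2) = (\<lambda>y. of_real (y\<^sup>2)) ` {y \<in> Z. y \<le> R}" if R: "R \<ge> 0" for R
  proof safe
    fix z assume "z \<in> zeros_upto F (R\<^sup>2)"
    hence z: "F z = 0" "norm z \<le> R\<^sup>2" by (auto simp: zeros_upto_def)
    then obtain t where t: "z = of_real t"
      using d(3) by (auto simp: real_simple_zeros_def elim: Reals_cases)
    have "t > 0" using alternating_real_rooted_zero_pos[OF good] z t by (simp add: F_def)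
    moreover have "sqrt t \<le> R" using z(2) t R \<open>t > 0\<close> by (simp add: real_le_lsqrt)
    ultimately have "sqrt t \<in> {y \<in> Z. y \<le> R}" "z = of_real ((sqrt t)\<^sup>2)"
      using z(1) t \<open>t > 0\<close> by (simp_all add: Z_iff del: of_real_power)
    thus "z \<in> (\<lambda>y. of_real (y\<^sup>2)) ` {y \<in> Z. y \<le> R}" by blast
  next
    fix y assume y: "y \<in> Z" "y \<le> R"
    hence "y\<^sup>2 \<le> R\<^sup>2" by (intro power_mono) (auto simp: Z_iff)
    thus "of_real (y\<^sup>2) \<in> zeros_upto F (R\<^sup>2)" using y by (simp add: zeros_upto_def Z_iff norm_power)
  qed
  have inj: "inj_on (\<lambda>y. complex_of_real (y\<^sup>2)) Z"
    by (rule inj_onI) (auto simp: Z_iff power2_eq_iff simp del: of_real_power)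
  have finZ: "finite {y \<in> Z. y \<le> R}" for R
  proof (cases "R \<ge> 0")
    case True
    have "inj_on (\<lambda>y. complex_of_real (y\<^sup>2)) {y \<in> Z. y \<le> R}" by (rule inj_on_subset[OF inj]) auto
    thus ?thesis using fin_upto[of "R\<^sup>2"] unfolding zeros_eq[OF True] by (rule finite_imageD[rotated])
  next
    case False
    hence "{y \<in> Z. y \<le> R} = {}" by (auto simp: Z_def)
    thus ?thesis by (simp only: finite.emptyI)
  qed
  have infZ: "infinite Z"
  proof
    assume "finite Z"
    moreover have "{z. F z = 0} \<subseteq> (\<lambda>y. of_real (y\<^sup>2)) ` Z"
    proof
      fix z assume "z \<in> {z. F z = 0}"
      hence "z \<in> zeros_upto F ((sqrt (norm z))\<^sup>2)" by (simp add: zeros_upto_def)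
      also have "\<dots> = (\<lambda>y. of_real (y\<^sup>2)) ` {y \<in> Z. y \<le> sqrt (norm z)}" by (rule zeros_eq) simp
      finally show "z \<in> (\<lambda>y. of_real (y\<^sup>2)) ` Z" by blast
    qed
    ultimately have "finite {z. F z = 0}" by (meson finite_imageI finite_subset)
    thus False using infinite_zeros_alternating[OF good] by (simp add: F_def)
  qed
  have lam_eq: "lam = kth_pos_zero (Bessel_N a b c \<nu>)"
    by (simp add: lam_def Bessel_N_zero_def fun_eq_iff)
  note kth = kth_pos_zero_enumerates[of "Bessel_N a b c \<nu>", folded Z_def lam_eq, OF infZ finZ]
  have lam_pos: "lam k > 0" if "k \<ge> 1" for k using kth(1)[OF that] by (simp add: Z_def)
  have x_pos: "x k \<ge> 0" if "k \<ge> 1" for k by (simp add: x_def)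
  have esym_eq: "esym (zeros_upto F ((lam K)\<^sup>2)) inverse m = of_real (esym {1..K} x m)" if K: "K \<ge> 1" for K m
  proof -
    have bij: "bij_betw (\<lambda>k. complex_of_real ((lam k)\<^sup>2)) {1..K} (zeros_upto F ((lam K)\<^sup>2))"
    proof -
      have "bij_betw (\<lambda>y. complex_of_real (y\<^sup>2)) {y \<in> Z. y \<le> lam K} (zeros_upto F ((lam K)\<^sup>2))"
        unfolding bij_betw_def using zeros_eq[OF less_imp_le[OF lam_pos[OF K]]] inj_on_subset[OF inj] by auto
      from bij_betw_trans[OF kth(2)[OF K] this] show ?thesis by (simp add: o_def)
    qed
    show ?thesis
      unfolding esym_reindex[OF bij] esym_of_real[symmetric] by (simp add: x_def)
  qed
  have e_lim: "(\<lambda>K. esym {1..K} x m) \<longlonglongrightarrow> e m" for m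
  proof -
    have "filterlim (\<lambda>K. (lam K)\<^sup>2) at_top sequentially"
      by (rule filterlim_compose[OF filterlim_pow_at_top[OF _ filterlim_ident] kth(3)]) simp
    from filterlim_compose[OF tendsto_esym_zeros_upto[OF d(1,2) d(3)[unfolded F_def], of m] this]
    have "(\<lambda>K. esym (zeros_upto F ((lam K)\<^sup>2)) inverse m) \<longlonglongrightarrow> of_real (e m)"
      by (simp add: F_def e_def)
    hence "(\<lambda>K. complex_of_real (esym {1..K} x m)) \<longlonglongrightarrow> of_real (e m)"
      by (rule Lim_transform_eventually)
         (rule eventually_mono[OF eventually_ge_at_top[of 1] esym_eq])
    thus ?thesis by (simp only: tendsto_of_real_iff)
  qed
  have e_val: "e m = Q a b c (2 * real m + \<nu>) / (fact m * 4 ^ m * pochhammer (\<nu> + 1) m * Q a b c \<nu>)" for m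
    by (simp add: e_def d_def N_coeff_def bessel_coeff_def mult_ac)
  have e0: "e 0 = 1" by (simp add: e_def d)
  have 1: "((\<lambda>ks. 1 / (\<Prod>k\<leftarrow>ks. (lam k) ^ 2)) has_sum e n)
      {ks :: nat list. length ks = n \<and> sorted_wrt (<) ks \<and> (\<forall>k\<in>set ks. 1 \<le> k)}"
  proof -
    have "(\<Prod>k\<leftarrow>ks. x k) = 1 / (\<Prod>k\<leftarrow>ks. (lam k) ^ 2)" for ks
      by (induction ks) (simp_all add: x_def divide_inverse)
    thus ?thesis using has_sum_esym[OF x_pos e_lim] by simp
  qed
  obtain p where p: "\<And>m. m \<ge> 1 \<Longrightarrow> (\<lambda>k. x (k + 1) ^ m) sums p m"
      "\<And>m. real m * ((-1) ^ m * e m) = - (\<Sum>i=1..m. ((-1) ^ (m - i) * e (m - i)) * p i)"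
    using power_sums_converge[OF e_lim e0] by blast
  define A where "A = (\<lambda>m. 4 ^ m * e m)"
  define s where "s = (\<lambda>m. 4 ^ m * (-1) ^ m * p m)"
  \<comment> \<open>The scaling by \<open>4\<^sup>m\<close> and the sign in \<open>s\<close> turn Newton's identities into the system of the matrix.\<close>
  define v where "v = (\<lambda>m. - real m * A m)"
  have rec: "v m = (\<Sum>i=1..m. A (m - i) * s i)" for m
  proof -
    have summand: "((-1) ^ m * 4 ^ m) * (((-1) ^ (m - i) * e (m - i)) * p i) = A (m - i) * s i"
      if "i \<in> {1..m}" for i
    proof -
      have m: "m = (m - i) + i" using that by simp
      have sgn: "(-1 :: real) ^ (m - i) * (-1) ^ (m - i) = 1" by (simp flip: power_add)
      have "((-1 :: real) ^ m * 4 ^ m) = ((-1) ^ (m - i) * (-1) ^ i) * (4 ^ (m - i) * 4 ^ i)"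
        by (subst (1 2) m) (simp only: power_add)
      hence "((-1) ^ m * 4 ^ m) * (((-1) ^ (m - i) * e (m - i)) * p i) =
          ((-1) ^ (m - i) * (-1) ^ (m - i)) * (A (m - i) * s i)"
        unfolding A_def s_def by (simp only: mult_ac)
      thus ?thesis unfolding sgn by simp
    qed
    have sgn: "(-1 :: real) ^ m * (-1) ^ m = 1" by (simp flip: power_add)
    have "v m = - (((-1) ^ m * (-1) ^ m) * (4 ^ m * (real m * e m)))"
      unfolding sgn by (simp add: v_def A_def)
    also have "\<dots> = - (((-1) ^ m * 4 ^ m) * (real m * ((-1) ^ m * e m)))" by (simp only: mult_ac)
    also have "\<dots> = (\<Sum>i=1..m. ((-1) ^ m * 4 ^ m) * (((-1) ^ (m - i) * e (m - i)) * p i))"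
      unfolding p(2) by (simp add: sum_distrib_left)
    also have "\<dots> = (\<Sum>i=1..m. A (m - i) * s i)" by (rule sum.cong[OF refl summand])
    finally show ?thesis .
  qed
  have M: "M_matrix a b c \<nu> n = Matrix.mat n n (\<lambda>(i, j). if j + 1 = n then v (i + 1)
            else if i > j then A (i - j) else if i = j then 1 else 0)"
  proof -
    have A: "A m = Q a b c (\<nu> + 2 * real m) / (fact m * pochhammer (\<nu> + 1) m * Q a b c \<nu>)" for m
      by (simp add: A_def e_val add.commute)
    have "M_entry a b c \<nu> n (i + 1) (j + 1) = (if j + 1 = n then v (i + 1)
            else if i > j then A (i - j) else if i = j then 1 else 0)" for i j
    proof -
      have "v (i + 1) = - Q a b c (\<nu> + 2 * real (i + 1)) / (fact i * pochhammer (\<nu> + 1) (i + 1) * Q a b c \<nu>)"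
        unfolding v_def A by (simp add: divide_simps del: of_nat_Suc)
      thus ?thesis unfolding M_entry_def A by simp
    qed
    thus ?thesis unfolding M_matrix_def by (simp only:)
  qed
  have "(\<lambda>k. 4 ^ n * (-1) ^ n * x (k + 1) ^ n) sums s n"
    unfolding s_def by (intro sums_mult p(1) assms)
  moreover have "4 ^ n * (-1) ^ n * x (k + 1) ^ n = 4 ^ n * (-1) ^ n / lam (k + 1) ^ (2 * n)" for k
    by (simp add: x_def power_mult power_inverse divide_inverse)
  moreover have "A 0 = 1" by (simp add: A_def e0)
  ultimately have 2: "(\<lambda>k. 4 ^ n * (-1) ^ n / lam (k + 1) ^ (2 * n)) sums Determinant.det (M_matrix a b c \<nu> n)"
    unfolding M using det_Cramer_last_column[OF assms(4) _ rec] by simp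
  show ?thesis using 1 2 unfolding e_val lam_def by blast
qed

end
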